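(* Let $\nu$ be a probability distribution supported on an ellipsoid $\{\theta\in\mathbb{R}^d:\|A\theta\|_2=1\}$ ($A$ symmetric positive semi-definite), $H=\mathbb{E}_\nu[\theta\theta^\top]$, $\tilde X=H^{1/2}X$, $\Sigma_H=H^{1/2}\Sigma H^{1/2}$. Assume there is $L_H>0$ with $\mathbb{E}[\|\tilde X\|_2^2\,\tilde X\tilde X^\top]\preceq L_H^2\Sigma_H$. Let $\lambda=\sigma^2/n$ and $\lambda_0=L_H^2/n$. Then $$\lambda\,\mathrm{df}_1(\Sigma_H;\lambda)\le \bar{\mathcal{E}}(\Sigma_H;\sigma^2)\le(\lambda+\lambda_0)\,\mathrm{df}_1(\Sigma_H;\lambda+\lambda_0).$$
   Context: Setting: $(X,Y)\in\mathbb{R}^d\times\mathbb{R}$ satisfies $Y=X^\top\theta_\star+\epsilon$ with $\mathbb{E}[\epsilon\mid X]=0$, $\mathbb{E}[\epsilon^2\mid X]=\sigma^2$; $\Sigma=\mathbb{E}[XX^\top]$. Training data $(X_i,Y_i)_{i\in[n]}$ are i.i.d. copies of $(X,Y)$, independent of a test pair. A linear prediction rule is $\hat f(x)=\sum_{i=1}^n l_i(x)Y_i$ with each $l_i$ a (possibly random) function of $x$, $(X_i)_{i\in[n]}$ and independent randomness. $R(f)=\mathbb{E}[(Y-f(X))^2]$, $\mathcal{E}_{\sigma^2}(\hat f)=\mathbb{E}[R(\hat f)]-\sigma^2$ (expectation over training data). $\bar{\mathcal{E}}(\Sigma_H;\sigma^2)$ denotes $\inf_{\hat f}\mathbb{E}_{\theta_\star\sim\nu}[\mathcal{E}_{\sigma^2}(\hat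 f)]$, infimum over linear prediction rules, $\theta_\star\sim\nu$ independent of the data. For $\lambda>0$, $\mathrm{df}_1(S;\lambda)=\mathrm{Tr}(S(S+\lambda I)^{-1})$. *)

theory Defs
  imports "HOL-Analysis.Analysis" "HOL-Probability.Probability"
begin

definition psd :: "real^'d^'d \<Rightarrow> bool" where
  "psd S \<longleftrightarrow> transpose S = S \<and> (\<forall>v. 0 \<le> v \<bullet> (S *v v))"

definition loewner_le :: "real^'d^'d \<Rightarrow> real^'d^'d \<Rightarrow> bool" where
  "loewner_le M N \<longleftrightarrow> psd (N - M)"

definition msqrt :: "real^'d^'d \<Rightarrow> real^'d^'d" where
  "msqrt H = (THE S. psd S \<and> S ** S = H)"

definition df1 :: "real^'d^'d \<Rightarrow> real \<Rightarrow> real" where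
  "df1 S lam = trace (S ** matrix_inv (S + lam *\<^sub>R mat 1))"

text \<open>P is the joint law of (X, epsilon). Second moment matrix of X.\<close>
definition Sigma_of :: "((real^'d) \<times> real) measure \<Rightarrow> real^'d^'d" where
  "Sigma_of P = (\<chi> i j. \<integral>z. (fst z)$i * (fst z)$j \<partial>P)"

definition second_moment :: "(real^'d) measure \<Rightarrow> real^'d^'d" where
  "second_moment \<nu> = (\<chi> i j. \<integral>\<theta>. \<theta>$i * \<theta>$j \<partial>\<nu>)"

text \<open>A linear prediction rule with n training points: a law Q for the auxiliary
  (independent) randomness xi and weights l xi Xs x i, where Xs are the training
  inputs and x the test input; the prediction is sum_i l xi Xs x i * Y_i.\<close>
definition lin_rule :: "nat \<Rightarrow> real measure \<Rightarrow>
    (real \<Rightarrow> (nat \<Rightarrow> real^'d) \<Rightarrow> real^'d \<Rightarrow> nat \<Rightarrow> real) \<Rightarrow> bool" where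
  "lin_rule n Q l \<longleftrightarrow> prob_space Q \<and> sets Q = sets borel \<and>
     (\<forall>i<n. (\<lambda>(\<xi>, Xs, x). l \<xi> Xs x i)
        \<in> borel_measurable (borel \<Otimes>\<^sub>M (PiM {..<n} (\<lambda>_. borel) \<Otimes>\<^sub>M borel)))"

text \<open>Prediction of the rule at x, given randomness xi, training sample D
  (D i = (X_i, epsilon_i)) and parameter theta (Y_i = X_i . theta + epsilon_i).\<close>
definition lin_pred :: "nat \<Rightarrow> (real \<Rightarrow> (nat \<Rightarrow> real^'d) \<Rightarrow> real^'d \<Rightarrow> nat \<Rightarrow> real) \<Rightarrow>
    real^'d \<Rightarrow> real \<Rightarrow> (nat \<Rightarrow> (real^'d) \<times> real) \<Rightarrow> real^'d \<Rightarrow> real" where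
  "lin_pred n l \<theta> \<xi> D x =
     (\<Sum>i<n. l \<xi> (\<lambda>j\<in>{..<n}. fst (D j)) x i * (fst (D i) \<bullet> \<theta> + snd (D i)))"

definition bayes_risk_rule :: "nat \<Rightarrow> ((real^'d) \<times> real) measure \<Rightarrow> (real^'d) measure \<Rightarrow>
    real measure \<Rightarrow> (real \<Rightarrow> (nat \<Rightarrow> real^'d) \<Rightarrow> real^'d \<Rightarrow> nat \<Rightarrow> real) \<Rightarrow> ennreal" where
  "bayes_risk_rule n P \<nu> Q l =
     (\<integral>\<^sup>+\<theta>. \<integral>\<^sup>+\<xi>. \<integral>\<^sup>+D. \<integral>\<^sup>+z.
        ennreal ((fst z \<bullet> \<theta> + snd z - lin_pred n l \<theta> \<xi> D (fst z))\<^sup>2)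
      \<partial>P \<partial>(PiM {..<n} (\<lambda>_. P)) \<partial>Q \<partial>\<nu>)"

definition bayes_excess :: "nat \<Rightarrow> ((real^'d) \<times> real) measure \<Rightarrow> (real^'d) measure \<Rightarrow> real \<Rightarrow> ereal" where
  "bayes_excess n P \<nu> \<sigma>2 =
     (INF Ql \<in> {(Q, l). lin_rule n Q l}.
        enn2ereal (bayes_risk_rule n P \<nu> (fst Ql) (snd Ql)) - ereal \<sigma>2)"

end

theory Submission
  imports Defs
begin

text \<open>
  Conditionally on the inputs, noise and signal are uncorrelated, so a linear rule with weights
  \<open>l\<close> has Bayes excess risk \<open>E [\<parallel>x - \<Sum> l\<^sub>i x\<^sub>i\<parallel>\<^sup>2 + \<sigma>\<^sup>2 \<Sum> l\<^sub>i\<^sup>2]\<close> in the whitened inputs \<open>x = H\<^bsup>1/2\<^esup> X\<close>.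
  With \<open>v\<^sub>\<mu> = (\<Sigma>\<^sub>H + \<mu>)\<^bsup>-1\<^esup> x\<close> both bounds avoid inverting the random sample covariance:
  Lagrangian duality with dual variable \<open>v\<^sub>\<lambda>\<close> bounds the excess risk of every rule from below by
  \<open>\<lambda> E [x \<bullet> v\<^sub>\<lambda>]\<close>, whereas the population ridge weights \<open>l\<^sub>i = x\<^sub>i \<bullet> v\<^sub>\<mu> / n\<close> with \<open>\<mu> = \<lambda> + \<lambda>\<^sub>0\<close>
  attain at most \<open>\<mu> E [x \<bullet> v\<^sub>\<mu>]\<close>, the fourth moment assumption controlling the variance of the mean
  of \<open>(x\<^sub>i \<bullet> v\<^sub>\<mu>) x\<^sub>i\<close>. Finally \<open>E [x \<bullet> v\<^sub>\<mu>] = df\<^sub>1(\<Sigma>\<^sub>H; \<mu>)\<close>.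
\<close>

section \<open>Square roots of positive semidefinite matrices\<close>

text \<open>A maximiser \<open>v\<close> of the Rayleigh quotient on the unit sphere of the
  invariant subspace is an eigenvector: moving \<open>v\<close> in the direction of the defect
  \<open>f v - \<mu> *\<^sub>R v\<close>, which stays inside \<open>V\<close>, would otherwise
  increase the quotient.\<close>

lemma selfadjoint_eigenvector:
  fixes f :: "'a::euclidean_space \<Rightarrow> 'a"
  assumes lin: "linear f" and sa: "\<And>x y. f x \<bullet> y = x \<bullet> f y"
    and V: "subspace V" "\<And>x. x \<in> V \<Longrightarrow> f x \<in> V" and ne: "V \<noteq> {0}"
  obtains v \<mu> where "v \<in> V" "norm v = 1" "f v = \<mu> *\<^sub>R v"
proof -
  let ?K = "V \<inter> sphere 0 1"
  have cpt: "compact ?K"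
    by (simp add: V(1) closed_Int_compact closed_subspace)
  obtain w where w: "w \<in> V" "w \<noteq> 0"
    using ne V(1) subspace_0 by blast
  then have "(1 / norm w) *\<^sub>R w \<in> ?K"
    using V(1) by (simp add: subspace_scale)
  then have ne': "?K \<noteq> {}" by blast
  have "continuous_on ?K (\<lambda>x. x \<bullet> f x)"
    using lin by (intro continuous_intros linear_continuous_on) (simp add: linear_conv_bounded_linear)
  from continuous_attains_sup[OF cpt ne' this]
  obtain v where v: "v \<in> V" "norm v = 1"
    and max: "\<And>y. y \<in> V \<Longrightarrow> norm y = 1 \<Longrightarrow> y \<bullet> f y \<le> v \<bullet> f v" by auto
  define \<mu> where "\<mu> = v \<bullet> f v"
  have quad: "y \<bullet> f y \<le> \<mu> * (y \<bullet> y)" if "y \<in> V" for y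
  proof (cases "y = 0")
    case True
    then show ?thesis by simp
  next
    case False
    have "((1 / norm y) *\<^sub>R y) \<bullet> f ((1 / norm y) *\<^sub>R y) \<le> \<mu>"
      unfolding \<mu>_def using False that V(1) by (intro max) (auto simp: subspace_scale)
    then have "(y \<bullet> f y) / (norm y)\<^sup>2 \<le> \<mu>"
      by (simp add: linear_scale[OF lin] power2_eq_square)
    then show ?thesis
      using False by (simp add: divide_le_eq power2_norm_eq_inner)
  qed
  define d where "d = f v - \<mu> *\<^sub>R v"
  have dV: "d \<in> V" unfolding d_def using v V by (simp add: subspace_diff subspace_scale)
  have vv: "v \<bullet> v = 1" using v by (simp add: norm_eq_1)
  have vd: "v \<bullet> d = 0" unfolding d_def using vv by (simp add: \<mu>_def inner_diff_right)
  define c where "c = \<mu> * (d \<bullet> d) - d \<bullet> f d"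
  \<comment> \<open>The bound \<open>quad\<close> is tested at the perturbed vector
    \<open>v + t *\<^sub>R d\<close>. Since \<open>d\<close> is orthogonal to \<open>v\<close> and
    \<open>v \<bullet> f d = d \<bullet> d\<close>, the first-order term is
    \<open>2 * t * (d \<bullet> d)\<close> and the rest is quadratic in \<open>t\<close>.\<close>
  have ineq: "2 * t * (d \<bullet> d) \<le> t\<^sup>2 * c" for t
  proof -
    have "(v + t *\<^sub>R d) \<bullet> f (v + t *\<^sub>R d) \<le> \<mu> * ((v + t *\<^sub>R d) \<bullet> (v + t *\<^sub>R d))"
      using v dV V by (intro quad) (simp add: subspace_add subspace_scale)
    moreover have "f v = d + \<mu> *\<^sub>R v" by (simp add: d_def)
    moreover have "v \<bullet> f d = d \<bullet> d"
      using sa[of v d] vd by (simp add: \<open>f v = d + \<mu> *\<^sub>R v\<close> inner_add_left)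
    ultimately show ?thesis
      using vd vv by (simp add: linear_add[OF lin] linear_scale[OF lin] inner_add_left inner_add_right
          inner_commute c_def power2_eq_square algebra_simps)
  qed
  have "d = 0"
  proof (rule ccontr)
    assume "d \<noteq> 0"
    then have dd: "0 < d \<bullet> d" by simp
    \<comment> \<open>Small enough that \<open>t * c\<close> is at most
      \<open>d \<bullet> d\<close>, against the bound
      \<open>2 * (d \<bullet> d) \<le> t * c\<close>; the added 1 covers
      \<open>c = 0\<close>.\<close>
    define t where "t = (d \<bullet> d) / (\<bar>c\<bar> + 1)"
    have tpos: "0 < t" using dd by (simp add: t_def add_nonneg_pos)
    then have "2 * (d \<bullet> d) \<le> t * c"
      using ineq[of t] by (simp add: power2_eq_square)
    also have "\<dots> \<le> t * (\<bar>c\<bar> + 1)" using tpos by (intro mult_left_mono) auto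
    also have "\<dots> = d \<bullet> d" by (simp add: t_def add_nonneg_pos)
    finally show False using dd by simp
  qed
  then show ?thesis using that v by (simp add: d_def)
qed

text \<open>Induction on the dimension of the invariant subspace: split off a unit eigenvector
  \<open>v\<close> and continue in the orthogonal complement of \<open>v\<close> within
  \<open>V\<close>, which is again invariant because \<open>f\<close> is self-adjoint.\<close>

lemma selfadjoint_eigenbasis:
  fixes f :: "'a::euclidean_space \<Rightarrow> 'a"
  assumes lin: "linear f" and sa: "\<And>x y. f x \<bullet> y = x \<bullet> f y"
    and V: "subspace V" "\<And>x. x \<in> V \<Longrightarrow> f x \<in> V"
  shows "\<exists>B. B \<subseteq> V \<and> finite B \<and> pairwise orthogonal B \<and> (\<forall>b\<in>B. norm b = 1 \<and> (\<exists>\<mu>. f b = \<mu> *\<^sub>R b))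
    \<and> V \<subseteq> span B"
  using V
proof (induction "dim V" arbitrary: V rule: less_induct)
  case less
  show ?case
  proof (cases "V = {0}")
    case True
    then show ?thesis by (intro exI[of _ "{}"]) auto
  next
    case False
    obtain v \<mu> where v: "v \<in> V" "norm v = 1" "f v = \<mu> *\<^sub>R v"
      using selfadjoint_eigenvector[OF lin sa less.prems False] by blast
    define W where "W = {x \<in> V. v \<bullet> x = 0}"
    have W: "subspace W"
      using less.prems(1) by (auto simp: W_def subspace_def inner_add_right)
    have fW: "f x \<in> W" if "x \<in> W" for x
      using that less.prems(2) sa[of v x] v by (auto simp: W_def)
    have "v \<notin> W" using v by (auto simp: W_def)
    then have "W \<subset> V" using v by (metis (no_types, lifting) W_def mem_Collect_eq psubsetI subsetI)
    then have "dim W < dim V"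
      using W less.prems(1) by (intro dim_psubset) (simp add: span_eq_iff[THEN iffD2])
    from less.hyps[OF this W fW] obtain B where B: "B \<subseteq> W" "finite B" "pairwise orthogonal B"
      "\<forall>b\<in>B. norm b = 1 \<and> (\<exists>\<mu>. f b = \<mu> *\<^sub>R b)" "W \<subseteq> span B" by blast
    have "V \<subseteq> span (insert v B)"
    proof
      fix x assume x: "x \<in> V"
      have "x - (v \<bullet> x) *\<^sub>R v \<in> W"
        using x v less.prems(1)
        by (simp add: W_def subspace_diff subspace_scale inner_diff_right norm_eq_1)
      then show "x \<in> span (insert v B)"
        using B(5) span_insert by blast
    qed
    moreover have "pairwise orthogonal (insert v B)"
      using B(1,3) by (auto simp: pairwise_insert W_def orthogonal_def inner_commute)
    ultimately show ?thesis
      using B v by (intro exI[of _ "insert v B"]) (auto simp: W_def)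
  qed
qed

lemma psd_inner_sym: "psd S \<Longrightarrow> (S *v x) \<bullet> y = x \<bullet> (S *v y)"
  by (metis dot_lmul_matrix psd_def transpose_matrix_vector)

lemma transpose_eqI:
  fixes S :: "real^'d^'d"
  assumes "\<And>x y. (S *v x) \<bullet> y = x \<bullet> (S *v y)"
  shows "transpose S = S"
proof -
  have "(S *v axis i 1) \<bullet> axis j 1 = axis i 1 \<bullet> (S *v axis j 1)" for i j
    by (rule assms)
  then show ?thesis
    by (simp add: vec_eq_iff transpose_def inner_axis inner_axis' matrix_vector_mult_basis column_def)
qed

text \<open>In an orthonormal eigenbasis of \<open>H\<close> the root multiplies each basis vector
  by the square root of its eigenvalue.\<close>

lemma psd_sqrt_exists:
  fixes H :: "real^'d^'d"
  assumes H: "psd H"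
  shows "\<exists>S. psd S \<and> S ** S = H"
proof -
  obtain B where B: "finite B" "pairwise orthogonal B" "\<And>b. b \<in> B \<Longrightarrow> norm b = 1"
      "\<And>b. b \<in> B \<Longrightarrow> \<exists>\<mu>. H *v b = \<mu> *\<^sub>R b" "UNIV \<subseteq> span B"
    using selfadjoint_eigenbasis[of "(*v) H" UNIV] psd_inner_sym[OF H] by auto
  \<comment> \<open>The Rayleigh value of a unit eigenvector is its eigenvalue. This formula names
    the eigenvalues without a choice and is visibly nonnegative.\<close>
  define \<mu> where "\<mu> b = b \<bullet> (H *v b)" for b
  have Hb: "H *v b = \<mu> b *\<^sub>R b" if "b \<in> B" for b
    using B(3,4)[OF that] by (auto simp: \<mu>_def norm_eq_1)
  have mu: "0 \<le> \<mu> b" for b using H by (simp add: psd_def \<mu>_def)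
  have expand: "(\<Sum>b\<in>B. (x \<bullet> b) *\<^sub>R b) = x" for x
    using B by (intro orthonormal_basis_expand) auto
  define s where "s x = (\<Sum>b\<in>B. (sqrt (\<mu> b) * (x \<bullet> b)) *\<^sub>R b)" for x
  have s: "linear s"
    by (rule linearI) (simp_all add: s_def inner_add_left distrib_left scaleR_add_left sum.distrib
        scaleR_sum_right algebra_simps)
  have sb: "s b = sqrt (\<mu> b) *\<^sub>R b" if "b \<in> B" for b
  proof -
    have "s b = (\<Sum>c\<in>B. if c = b then sqrt (\<mu> b) *\<^sub>R b else 0)"
      unfolding s_def using B(2,3) that
      by (intro sum.cong) (auto simp: pairwise_def orthogonal_def norm_eq_1)
    then show ?thesis using that B(1) by simp
  qed
  have Sv: "matrix s *v x = s x" for x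
    using s by (simp add: matrix_works)
  have inner_s: "s x \<bullet> y = (\<Sum>b\<in>B. sqrt (\<mu> b) * (x \<bullet> b) * (b \<bullet> y))" for x y
    by (simp add: s_def inner_sum_left)
  have "psd (matrix s)"
    unfolding psd_def
  proof (intro conjI allI)
    show "transpose (matrix s) = matrix s"
    proof (rule transpose_eqI, unfold Sv)
      show "s x \<bullet> y = x \<bullet> s y" for x y
        using inner_s[of x y] inner_s[of y x]
        by (simp add: inner_commute mult.commute mult.left_commute)
    qed
    show "0 \<le> v \<bullet> (matrix s *v v)" for v
      unfolding Sv by (subst inner_commute)
        (auto simp: inner_s inner_commute[of v] mult.assoc mu intro!: sum_nonneg)
  qed
  moreover have "matrix s ** matrix s = H"
  proof -
    have "s (s x) = H *v x" for x
    proof -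
      have "s (s x) = (\<Sum>b\<in>B. (x \<bullet> b) *\<^sub>R s (s b))"
        by (subst expand[of x, symmetric]) (simp add: linear_sum[OF s] linear_scale[OF s])
      also have "\<dots> = (\<Sum>b\<in>B. (x \<bullet> b) *\<^sub>R (H *v b))"
        by (intro sum.cong refl) (simp add: sb Hb linear_scale[OF s] mu)
      also have "\<dots> = H *v (\<Sum>b\<in>B. (x \<bullet> b) *\<^sub>R b)"
        by (simp add: linear_sum[OF matrix_vector_mul_linear] matrix_vector_mult_scaleR)
      finally show ?thesis by (simp only: expand)
    qed
    then show ?thesis
      by (simp add: matrix_eq matrix_vector_mul_assoc[symmetric] Sv)
  qed
  ultimately show ?thesis by blast
qed

lemma trace_eq_sum_inner:
  fixes A :: "real^'d^'d"
  shows "trace A = (\<Sum>i\<in>UNIV. axis i 1 \<bullet> (A *v axis i 1))"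
  by (simp add: trace_def inner_axis' matrix_vector_mult_basis column_def)

text \<open>If \<open>S\<^sup>2 = T\<^sup>2\<close> and \<open>D = S - T\<close>, then \<open>SD + DT = 0\<close>, so the traces of the positive
  semidefinite matrices \<open>DSD\<close> and \<open>DTD\<close> add up to zero; both vanish, and so does
  \<open>D\<^sup>3 = DSD - DTD\<close>.\<close>
lemma psd_sqrt_unique:
  fixes S T :: "real^'d^'d"
  assumes S: "psd S" and T: "psd T" and eq: "S ** S = T ** T"
  shows "S = T"
proof -
  define D where "D = S - T"
  have Dv: "D *v x = S *v x - T *v x" for x
    by (simp add: D_def matrix_vector_mult_diff_rdistrib)
  have Dsym: "(D *v x) \<bullet> y = x \<bullet> (D *v y)" for x y
    by (simp add: Dv inner_diff_left inner_diff_right psd_inner_sym[OF S] psd_inner_sym[OF T])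
  have SST: "S *v (S *v x) = T *v (T *v x)" for x
    using eq by (simp add: matrix_vector_mul_assoc)
  have comm: "S *v (D *v x) + D *v (T *v x) = 0" for x
    by (simp add: Dv matrix_vector_mult_diff_distrib SST)
  \<comment> \<open>Cyclicity of the trace moves \<open>T\<close> between two copies of
    \<open>D\<close>, so that each summand becomes a quadratic form evaluated at
    \<open>D *v axis i 1\<close>.\<close>
  have "trace (D ** (D ** T)) = trace ((D ** T) ** D)" by (rule trace_mul_sym)
  moreover have "trace (D ** (S ** D)) + trace (D ** (D ** T)) = 0"
    by (simp add: trace_eq_sum_inner matrix_vector_mul_assoc[symmetric] sum.distrib[symmetric]
        inner_add_right[symmetric] matrix_vector_right_distrib[symmetric] comm)
  ultimately have tr: "trace (D ** (S ** D)) + trace ((D ** T) ** D) = 0" by simp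
  have form: "x \<bullet> (D *v (R *v (D *v x))) = (D *v x) \<bullet> (R *v (D *v x))" for R x
    by (simp add: Dsym)
  have "(\<Sum>i\<in>UNIV. (D *v axis i 1) \<bullet> (S *v (D *v axis i 1)) + (D *v axis i 1) \<bullet> (T *v (D *v axis i 1))) = 0"
    using tr by (simp add: trace_eq_sum_inner matrix_vector_mul_assoc[symmetric] sum.distrib form)
  then have z: "(D *v axis i 1) \<bullet> (S *v (D *v axis i 1)) + (D *v axis i 1) \<bullet> (T *v (D *v axis i 1)) = 0" for i
    using S T by (subst (asm) sum_nonneg_eq_0_iff) (auto simp: psd_def)
  \<comment> \<open>A positive semidefinite form vanishes only on the kernel: with
    \<open>R = Q ** Q\<close> its value at \<open>w\<close> is the squared norm of
    \<open>Q *v w\<close>.\<close>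
  have psd0: "R *v w = 0" if R: "psd R" and w: "w \<bullet> (R *v w) = 0" for R :: "real^'d^'d" and w
  proof -
    obtain Q where Q: "psd Q" "Q ** Q = R" using psd_sqrt_exists[OF R] by blast
    have Rw: "R *v w = Q *v (Q *v w)"
      by (simp add: Q(2) matrix_vector_mul_assoc)
    have "(Q *v w) \<bullet> (Q *v w) = 0"
      using w by (simp add: Rw psd_inner_sym[OF Q(1)])
    then show ?thesis by (simp add: Rw)
  qed
  \<comment> \<open>Both \<open>S\<close> and \<open>T\<close> annihilate
    \<open>D *v axis i 1\<close>, hence so does their difference; by symmetry of \<open>D\<close>,
    this makes every column of \<open>D\<close> a vector of norm zero.\<close>
  have "D *v (D *v axis i 1) = 0" for i
  proof -
    let ?w = "D *v axis i 1"
    have "0 \<le> ?w \<bullet> (S *v ?w)" "0 \<le> ?w \<bullet> (T *v ?w)" using S T by (auto simp: psd_def)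
    with z[of i] have "?w \<bullet> (S *v ?w) = 0" "?w \<bullet> (T *v ?w) = 0" by linarith+
    then have "S *v ?w = 0" "T *v ?w = 0" using psd0[OF S] psd0[OF T] by blast+
    then show ?thesis by (simp add: Dv[of ?w])
  qed
  then have "(D *v axis i 1) \<bullet> (D *v axis i 1) = 0" for i
    by (simp add: Dsym)
  then have "column i D = 0" for i
    by (simp add: matrix_vector_mult_basis)
  then have "D = 0" by (simp add: vec_eq_iff column_def)
  then show ?thesis by (simp add: D_def)
qed

lemma msqrt:
  assumes "psd H"
  shows psd_msqrt: "psd (msqrt H)" and msqrt_mult: "msqrt H ** msqrt H = H"
proof -
  have "\<exists>!S. psd S \<and> S ** S = H"
    using psd_sqrt_exists[OF assms] psd_sqrt_unique by blast
  from theI'[OF this] show "psd (msqrt H)" "msqrt H ** msqrt H = H"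
    by (simp_all add: msqrt_def)
qed

section \<open>Conditionally centred noise\<close>

text \<open>Continuity from below of the measures with densities \<open>f\<close> and
  \<open>g\<close>. It lets an identity proved under truncation pass to the limit, where both sides
  may be infinite.\<close>

lemma nn_integral_eqI_incseq:
  fixes f g :: "'a \<Rightarrow> ennreal" and A :: "nat \<Rightarrow> 'a set"
  assumes [measurable]: "f \<in> borel_measurable M" "g \<in> borel_measurable M" "\<And>k. A k \<in> sets M"
    and "incseq A" "(\<Union>k. A k) = space M"
    and eq: "\<And>k. (\<integral>\<^sup>+x. f x * indicator (A k) x \<partial>M) = (\<integral>\<^sup>+x. g x * indicator (A k) x \<partial>M)"
  shows "(\<integral>\<^sup>+x. f x \<partial>M) = (\<integral>\<^sup>+x. g x \<partial>M)"
proof -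
  have *: "(\<integral>\<^sup>+x. h x \<partial>M) = (SUP k. \<integral>\<^sup>+x. h x * indicator (A k) x \<partial>M)"
    if [measurable]: "h \<in> borel_measurable M" for h
  proof -
    have "(SUP k. emeasure (density M h) (A k)) = emeasure (density M h) (\<Union>k. A k)"
      using assms(4) by (intro SUP_emeasure_incseq) auto
    also have "\<dots> = (\<integral>\<^sup>+x. h x * indicator (space M) x \<partial>M)"
      by (simp add: assms(5) emeasure_density)
    also have "\<dots> = (\<integral>\<^sup>+x. h x \<partial>M)" by (intro nn_integral_cong) auto
    finally show ?thesis by (simp add: emeasure_density)
  qed
  show ?thesis by (simp add: * eq)
qed

text \<open>The conditional moments of \<open>e\<close> given \<open>X\<close> are expressed by
  testing against the events generated by \<open>X\<close>. The target space \<open>N\<close> is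
  kept abstract so that the locale applies both to the regression noise and, with a one-point
  \<open>N\<close>, to a plain centred variable.\<close>

locale cond_noise = prob_space M for M :: "'a measure" +
  fixes N :: "'b measure" and X :: "'a \<Rightarrow> 'b" and e :: "'a \<Rightarrow> real" and s :: real
  assumes X [measurable]: "X \<in> M \<rightarrow>\<^sub>M N" and e [measurable]: "e \<in> borel_measurable M"
    and e_sq: "integrable M (\<lambda>z. (e z)\<^sup>2)"
    and mean: "\<And>B. B \<in> sets N \<Longrightarrow> (\<integral>z. indicator B (X z) * e z \<partial>M) = 0"
    and var: "\<And>B. B \<in> sets N \<Longrightarrow>
      (\<integral>z. indicator B (X z) * (e z)\<^sup>2 \<partial>M) = s * (\<integral>z. indicator B (X z) \<partial>M)"
begin

lemma s_eq: "s = (\<integral>z. (e z)\<^sup>2 \<partial>M)"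
proof -
  have "(\<integral>z. indicator (space N) (X z) * (e z)\<^sup>2 \<partial>M) = (\<integral>z. (e z)\<^sup>2 \<partial>M)"
    by (intro Bochner_Integration.integral_cong) (auto dest: measurable_space[OF X])
  moreover have "(\<integral>z. indicator (space N) (X z) \<partial>M) = (\<integral>z. (1::real) \<partial>M)"
    by (intro Bochner_Integration.integral_cong) (auto dest: measurable_space[OF X])
  ultimately show ?thesis using var[of "space N"] by (simp add: prob_space)
qed

lemma s_nonneg: "0 \<le> s"
  by (simp add: s_eq)

lemma e_int: "integrable M e"
  using e_sq by (rule square_integrable_imp_integrable[OF e])

text \<open>The hypothesis on \<open>h\<close> says that its conditional expectation given
  \<open>X\<close> is zero; the factor \<open>f (X z)\<close> is measurable for the \<sigma>-algebra
  generated by \<open>X\<close> and can be pulled out.\<close>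

lemma integral_mult_eq_0:
  assumes h: "integrable M h" "\<And>B. B \<in> sets N \<Longrightarrow> (\<integral>z. indicator B (X z) * h z \<partial>M) = 0"
    and f [measurable]: "f \<in> borel_measurable N" and "integrable M (\<lambda>z. f (X z) * h z)"
  shows "(\<integral>z. f (X z) * h z \<partial>M) = (0::real)"
proof -
  define F where "F = vimage_algebra (space M) X N"
  have XF: "X \<in> F \<rightarrow>\<^sub>M N"
    unfolding F_def using measurable_space[OF X] by (intro measurable_vimage_algebra1) auto
  have setsF: "sets F = {X -` B \<inter> space M | B. B \<in> sets N}"
    unfolding F_def using measurable_space[OF X] by (intro sets_vimage_algebra2) auto
  have "subalgebra M F"
    unfolding subalgebra_def setsF using measurable_sets[OF X] by (auto simp: F_def)
  then interpret F: finite_measure_subalgebra M F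
    by unfold_locales
  have "AE x in M. real_cond_exp M F h x = 0"
  proof (rule F.real_cond_exp_charact)
    fix A assume "A \<in> sets F"
    then obtain B where B: "B \<in> sets N" "A = X -` B \<inter> space M" by (auto simp: setsF)
    have "(\<integral>x\<in>A. h x \<partial>M) = (\<integral>z. indicator B (X z) * h z \<partial>M)"
      unfolding set_lebesgue_integral_def
      by (intro Bochner_Integration.integral_cong) (auto simp: B(2) indicator_def)
    then show "(\<integral>x\<in>A. h x \<partial>M) = (\<integral>x\<in>A. 0 \<partial>M)" using h(2)[OF B(1)] by simp
  qed (use h in auto)
  moreover have fF: "(\<lambda>z. f (X z)) \<in> borel_measurable F"
    using XF by measurable
  have hm: "h \<in> borel_measurable M" using h by auto
  have "(\<integral>z. f (X z) * real_cond_exp M F h z \<partial>M) = (\<integral>z. f (X z) * h z \<partial>M)"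
    using assms(4) fF hm by (rule F.real_cond_exp_intg)
  moreover have "(\<integral>z. f (X z) * real_cond_exp M F h z \<partial>M) = (\<integral>z. 0 \<partial>M)"
    using \<open>AE x in M. real_cond_exp M F h x = 0\<close> fF
    by (intro integral_cong_AE) (auto intro: measurable_compose[OF X])
  ultimately show ?thesis by simp
qed

text \<open>The square is expanded. The cross term has mean zero because \<open>e\<close> is
  conditionally centred, and in the last term \<open>(e z)\<^sup>2\<close> may be replaced by
  \<open>s\<close>. Boundedness of \<open>p\<close> and \<open>g\<close> makes every term
  integrable.\<close>

lemma noise_bounded:
  assumes [measurable]: "p \<in> borel_measurable N" "g \<in> borel_measurable N"
    and bd: "\<And>y. \<bar>p y\<bar> \<le> K" "\<And>y. \<bar>g y\<bar> \<le> K"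
  shows "(\<integral>\<^sup>+z. ennreal ((p (X z) + g (X z) * e z)\<^sup>2) \<partial>M)
       = (\<integral>\<^sup>+z. ennreal ((p (X z))\<^sup>2 + s * (g (X z))\<^sup>2) \<partial>M)"
proof -
  have K: "0 \<le> K" using bd(1)[of undefined] by linarith
  have prod: "\<bar>a * b\<bar> \<le> K\<^sup>2" if "\<bar>a\<bar> \<le> K" "\<bar>b\<bar> \<le> K" for a b
    using that by (simp add: abs_mult power2_eq_square mult_mono)
  have sq: "(p y)\<^sup>2 \<le> K\<^sup>2" "(g y)\<^sup>2 \<le> K\<^sup>2" for y
    using bd[of y] K by (simp_all add: abs_le_square_iff[symmetric])
  have pp: "integrable M (\<lambda>z. (p (X z))\<^sup>2)" and gg: "integrable M (\<lambda>z. (g (X z))\<^sup>2)"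
    using sq by (intro integrable_const_bound[where B="K\<^sup>2"]; simp)+
  have pge: "integrable M (\<lambda>z. (p (X z) * g (X z)) * e z)"
    using prod[OF bd(1) bd(2)]
    by (intro Bochner_Integration.integrable_bound[OF integrable_mult_right[OF e_int, of "K\<^sup>2"]])
       (auto simp: abs_mult[of _ "e _"] intro!: mult_right_mono)
  have ggee: "integrable M (\<lambda>z. (g (X z))\<^sup>2 * (e z)\<^sup>2)"
    using sq(2)
    by (intro Bochner_Integration.integrable_bound[OF integrable_mult_right[OF e_sq, of "K\<^sup>2"]])
       (auto intro!: mult_right_mono)
  have pg: "(\<lambda>y. p y * g y) \<in> borel_measurable N" by measurable
  have e1: "(\<integral>z. (p (X z) * g (X z)) * e z \<partial>M) = 0"
    using e_int mean pg pge by (rule integral_mult_eq_0)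
  have ggs: "integrable M (\<lambda>z. (g (X z))\<^sup>2 * ((e z)\<^sup>2 - s))"
    using ggee gg by (simp add: right_diff_distrib)
  \<comment> \<open>The variance assumption says that \<open>(e z)\<^sup>2 - s\<close> is itself
    conditionally centred, so the same pull-out lemma applies with the factor
    \<open>(g y)\<^sup>2\<close>.\<close>
  have "(\<integral>z. (g (X z))\<^sup>2 * ((e z)\<^sup>2 - s) \<partial>M) = 0"
  proof (rule integral_mult_eq_0[where f="\<lambda>y. (g y)\<^sup>2" and h="\<lambda>z. (e z)\<^sup>2 - s", OF _ _ _ ggs])
    show "integrable M (\<lambda>z. (e z)\<^sup>2 - s)" using e_sq by simp
    fix B assume B[measurable]: "B \<in> sets N"
    have i1: "integrable M (\<lambda>z. indicator B (X z) * (e z)\<^sup>2)"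
      by (intro Bochner_Integration.integrable_bound[OF e_sq]) (auto simp: indicator_def)
    have i2: "integrable M (\<lambda>z. indicator B (X z) :: real)"
      by (intro integrable_const_bound[where B=1]) (auto simp: indicator_def)
    show "(\<integral>z. indicator B (X z) * ((e z)\<^sup>2 - s) \<partial>M) = 0"
      using i1 i2 var[OF B] by (simp add: right_diff_distrib mult.commute)
  qed measurable
  then have e2: "(\<integral>z. (g (X z))\<^sup>2 * (e z)\<^sup>2 \<partial>M) = s * (\<integral>z. (g (X z))\<^sup>2 \<partial>M)"
    using ggee gg by (simp add: right_diff_distrib mult.commute)
  have expand: "(p (X z) + g (X z) * e z)\<^sup>2
      = (p (X z))\<^sup>2 + (2 * ((p (X z) * g (X z)) * e z) + (g (X z))\<^sup>2 * (e z)\<^sup>2)" for z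
    by (simp add: power2_eq_square algebra_simps)
  have "(\<integral>\<^sup>+z. ennreal ((p (X z) + g (X z) * e z)\<^sup>2) \<partial>M) = ennreal (\<integral>z. (p (X z) + g (X z) * e z)\<^sup>2 \<partial>M)"
    by (intro nn_integral_eq_integral) (use pp pge ggee in \<open>simp_all add: expand\<close>, simp flip: expand)
  also have "(\<integral>z. (p (X z) + g (X z) * e z)\<^sup>2 \<partial>M) = (\<integral>z. (p (X z))\<^sup>2 + s * (g (X z))\<^sup>2 \<partial>M)"
    unfolding expand using pp pge ggee gg e1 e2 by simp
  also have "ennreal \<dots> = (\<integral>\<^sup>+z. ennreal ((p (X z))\<^sup>2 + s * (g (X z))\<^sup>2) \<partial>M)"
    using pp gg s_nonneg by (intro nn_integral_eq_integral[symmetric]) auto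
  finally show ?thesis .
qed

text \<open>Truncation to the event that \<open>p\<close> and \<open>g\<close> are at most
  \<open>k\<close> in absolute value reduces to the bounded case. The event depends on
  \<open>X\<close> alone, so truncating does not disturb the conditional moments of the
  noise.\<close>

lemma noise_single:
  assumes [measurable]: "p \<in> borel_measurable N" "g \<in> borel_measurable N"
  shows "(\<integral>\<^sup>+z. ennreal ((p (X z) + g (X z) * e z)\<^sup>2) \<partial>M)
       = (\<integral>\<^sup>+z. ennreal ((p (X z))\<^sup>2 + s * (g (X z))\<^sup>2) \<partial>M)"
proof (rule nn_integral_eqI_incseq)
  define A where "A k = {z \<in> space M. \<bar>p (X z)\<bar> \<le> real k \<and> \<bar>g (X z)\<bar> \<le> real k}" for k
  show "A k \<in> sets M" for k unfolding A_def by measurable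
  show "incseq A" unfolding A_def incseq_def by auto
  show "(\<Union>k. A k) = space M"
  proof (intro equalityI subsetI)
    fix z assume "z \<in> space M"
    moreover obtain k where "max \<bar>p (X z)\<bar> \<bar>g (X z)\<bar> \<le> real k" using real_arch_simple by blast
    ultimately show "z \<in> (\<Union>k. A k)" by (auto simp: A_def)
  qed (auto simp: A_def)
  fix k
  \<comment> \<open>The indicator of the truncation event as a function of the input. Being 0 or 1,
    it can be absorbed into \<open>p\<close> and \<open>g\<close> inside the squares.\<close>
  define c :: "'b \<Rightarrow> real" where "c y = (if \<bar>p y\<bar> \<le> real k \<and> \<bar>g y\<bar> \<le> real k then 1 else 0)" for y
  have [measurable]: "c \<in> borel_measurable N" unfolding c_def by measurable
  have "(\<integral>\<^sup>+z. ennreal ((c (X z) * p (X z) + c (X z) * g (X z) * e z)\<^sup>2) \<partial>M)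
       = (\<integral>\<^sup>+z. ennreal ((c (X z) * p (X z))\<^sup>2 + s * (c (X z) * g (X z))\<^sup>2) \<partial>M)"
    by (rule noise_bounded[where p="\<lambda>y. c y * p y" and g="\<lambda>y. c y * g y" and K="real k"])
       (auto simp: c_def)
  moreover have "(\<integral>\<^sup>+z. ennreal ((p (X z) + g (X z) * e z)\<^sup>2) * indicator (A k) z \<partial>M)
      = (\<integral>\<^sup>+z. ennreal ((c (X z) * p (X z) + c (X z) * g (X z) * e z)\<^sup>2) \<partial>M)"
    by (intro nn_integral_cong) (auto simp: A_def c_def)
  moreover have "(\<integral>\<^sup>+z. ennreal ((p (X z))\<^sup>2 + s * (g (X z))\<^sup>2) * indicator (A k) z \<partial>M)
      = (\<integral>\<^sup>+z. ennreal ((c (X z) * p (X z))\<^sup>2 + s * (c (X z) * g (X z))\<^sup>2) \<partial>M)"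
    by (intro nn_integral_cong) (auto simp: A_def c_def)
  ultimately show "(\<integral>\<^sup>+z. ennreal ((p (X z) + g (X z) * e z)\<^sup>2) * indicator (A k) z \<partial>M)
       = (\<integral>\<^sup>+z. ennreal ((p (X z))\<^sup>2 + s * (g (X z))\<^sup>2) * indicator (A k) z \<partial>M)"
    by simp
qed measurable

text \<open>Noise terms of different sample points are uncorrelated even though every weight may
  depend on all inputs. The coordinates are added one at a time: the new noise is averaged out with
  the other points fixed, then the induction hypothesis treats the old noises with the new input
  fixed.\<close>

lemma noise_PiM:
  assumes "finite I" "p \<in> borel_measurable (PiM I (\<lambda>_. N))"
    and "\<And>i. i \<in> I \<Longrightarrow> g i \<in> borel_measurable (PiM I (\<lambda>_. N))"
  shows "(\<integral>\<^sup>+\<omega>. ennreal ((p (\<lambda>j\<in>I. X (\<omega> j)) + (\<Sum>i\<in>I. g i (\<lambda>j\<in>I. X (\<omega> j)) * e (\<omega> i)))\<^sup>2) \<partial>PiM I (\<lambda>_. M))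
       = (\<integral>\<^sup>+\<omega>. ennreal ((p (\<lambda>j\<in>I. X (\<omega> j)))\<^sup>2 + s * (\<Sum>i\<in>I. (g i (\<lambda>j\<in>I. X (\<omega> j)))\<^sup>2)) \<partial>PiM I (\<lambda>_. M))"
  using assms
proof (induction I arbitrary: p g rule: finite_induct)
  case empty
  then show ?case by simp
next
  case (insert i I)
  interpret product_sigma_finite "\<lambda>_. M" by unfold_locales
  interpret PI: sigma_finite_measure "PiM I (\<lambda>_. M)"
    using sigma_finite[OF insert.hyps(1)] .
  interpret pair_sigma_finite "PiM I (\<lambda>_. M)" M by unfold_locales
  define R where "R \<omega> = (\<lambda>j\<in>I. X (\<omega> j))" for \<omega>
  define U where "U \<omega> z = (R \<omega>)(i := X z)" for \<omega> z
  note [measurable] = insert.prems(1)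
  have g[measurable]: "g j \<in> borel_measurable (PiM (insert i I) (\<lambda>_. N))" if "j \<in> insert i I" for j
    using insert.prems(2) that .
  have gi[measurable]: "g i \<in> borel_measurable (PiM (insert i I) (\<lambda>_. N))" by (rule g) simp
  have R[measurable]: "R \<in> PiM I (\<lambda>_. M) \<rightarrow>\<^sub>M PiM I (\<lambda>_. N)"
    unfolding R_def by measurable
  have upd: "(\<lambda>(Y, x). Y(i := x)) \<in> PiM I (\<lambda>_. N) \<Otimes>\<^sub>M N \<rightarrow>\<^sub>M PiM (insert i I) (\<lambda>_. N)"
    by (rule measurable_add_dim)
  have updc[measurable (raw)]: "(\<lambda>w. (a w)(i := b w)) \<in> L \<rightarrow>\<^sub>M PiM (insert i I) (\<lambda>_. N)"
    if "a \<in> L \<rightarrow>\<^sub>M PiM I (\<lambda>_. N)" "b \<in> L \<rightarrow>\<^sub>M N" for a b and L :: "'z measure"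
    using measurable_compose[OF measurable_Pair[OF that] upd] by simp
  have restr: "(\<lambda>j\<in>insert i I. X (if j = i then z else \<omega> j)) = U \<omega> z" for \<omega> z
    using insert.hyps(2) by (auto simp: U_def R_def fun_eq_iff restrict_def)
  have in_I: "(\<Sum>j\<in>I. f j (e (if j = i then z else \<omega> j))) = (\<Sum>j\<in>I. f j (e (\<omega> j)))"
    for f :: "_ \<Rightarrow> _ \<Rightarrow> real" and \<omega> z
    using insert.hyps(2) by (intro sum.cong) auto
  have U[measurable]: "(\<lambda>w. U (a w) (b w)) \<in> L \<rightarrow>\<^sub>M PiM (insert i I) (\<lambda>_. N)"
    if [measurable]: "a \<in> L \<rightarrow>\<^sub>M PiM I (\<lambda>_. M)" "b \<in> L \<rightarrow>\<^sub>M M" for a b and L :: "'z measure"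
    unfolding U_def by measurable
  let ?\<Pi> = "PiM I (\<lambda>_. M)"
  \<comment> \<open>Everything except the noise of the new coordinate; for fixed old points it is a
    function of the new input only.\<close>
  let ?q = "\<lambda>\<omega> z. p (U \<omega> z) + (\<Sum>j\<in>I. g j (U \<omega> z) * e (\<omega> j))"
  have "(\<integral>\<^sup>+\<omega>. ennreal ((p (\<lambda>j\<in>insert i I. X (\<omega> j)) +
          (\<Sum>k\<in>insert i I. g k (\<lambda>j\<in>insert i I. X (\<omega> j)) * e (\<omega> k)))\<^sup>2) \<partial>PiM (insert i I) (\<lambda>_. M))
      = (\<integral>\<^sup>+\<omega>. \<integral>\<^sup>+z. ennreal ((?q \<omega> z + g i (U \<omega> z) * e z)\<^sup>2) \<partial>M \<partial>?\<Pi>)"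
    using insert.hyps
    by (subst product_nn_integral_insert)
       (auto simp: fun_upd_def restr in_I[of "\<lambda>j. (*) (g j (U _ _))"] ac_simps)
  also have "\<dots> = (\<integral>\<^sup>+\<omega>. \<integral>\<^sup>+z. ennreal ((?q \<omega> z)\<^sup>2 + s * (g i (U \<omega> z))\<^sup>2) \<partial>M \<partial>?\<Pi>)"
  proof (rule nn_integral_cong)
    fix \<omega> assume [measurable]: "\<omega> \<in> space ?\<Pi>"
    have [measurable]: "(\<lambda>x. (R \<omega>)(i := x)) \<in> N \<rightarrow>\<^sub>M PiM (insert i I) (\<lambda>_. N)"
      using measurable_space[OF R] by (intro updc) auto
    show "(\<integral>\<^sup>+z. ennreal ((?q \<omega> z + g i (U \<omega> z) * e z)\<^sup>2) \<partial>M)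
        = (\<integral>\<^sup>+z. ennreal ((?q \<omega> z)\<^sup>2 + s * (g i (U \<omega> z))\<^sup>2) \<partial>M)"
      unfolding U_def
      by (rule noise_single[where g="\<lambda>x. g i ((R \<omega>)(i := x))"
            and p="\<lambda>x. p ((R \<omega>)(i := x)) + (\<Sum>j\<in>I. g j ((R \<omega>)(i := x)) * e (\<omega> j))"]) measurable
  qed
  \<comment> \<open>Exchanging the integrals leaves the old coordinates innermost.\<close>
  also have "\<dots> = (\<integral>\<^sup>+z. \<integral>\<^sup>+\<omega>. ennreal ((?q \<omega> z)\<^sup>2 + s * (g i (U \<omega> z))\<^sup>2) \<partial>?\<Pi> \<partial>M)"
    by (rule Fubini'[symmetric]) measurable
  also have "\<dots> = (\<integral>\<^sup>+z. \<integral>\<^sup>+\<omega>. ennreal ((p (U \<omega> z))\<^sup>2 + s * (\<Sum>k\<in>insert i I. (g k (U \<omega> z))\<^sup>2)) \<partial>?\<Pi> \<partial>M)"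
  proof (rule nn_integral_cong)
    fix z assume z[measurable]: "z \<in> space M"
    have "X z \<in> space N" using measurable_space[OF X z] .
    then have [measurable]: "(\<lambda>Y. Y(i := X z)) \<in> PiM I (\<lambda>_. N) \<rightarrow>\<^sub>M PiM (insert i I) (\<lambda>_. N)"
      by (intro updc) auto
    \<comment> \<open>The induction hypothesis is used for the functions with the new input
      \<open>X z\<close> already inserted; this is why \<open>p\<close> and \<open>g\<close> are
      generalised in the induction.\<close>
    have IH: "(\<integral>\<^sup>+\<omega>. ennreal ((?q \<omega> z)\<^sup>2) \<partial>?\<Pi>)
        = (\<integral>\<^sup>+\<omega>. ennreal ((p (U \<omega> z))\<^sup>2 + s * (\<Sum>k\<in>I. (g k (U \<omega> z))\<^sup>2)) \<partial>?\<Pi>)"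
      unfolding U_def R_def
    proof (rule insert.IH[of "\<lambda>Y. p (Y(i := X z))" "\<lambda>j Y. g j (Y(i := X z))"])
      fix j assume "j \<in> I"
      then have [measurable]: "g j \<in> borel_measurable (PiM (insert i I) (\<lambda>_. N))" by (intro g) simp
      show "(\<lambda>Y. g j (Y(i := X z))) \<in> borel_measurable (PiM I (\<lambda>_. N))" by measurable
    qed measurable
    have "(\<integral>\<^sup>+\<omega>. ennreal ((?q \<omega> z)\<^sup>2 + s * (g i (U \<omega> z))\<^sup>2) \<partial>?\<Pi>)
        = (\<integral>\<^sup>+\<omega>. ennreal ((?q \<omega> z)\<^sup>2) \<partial>?\<Pi>) + (\<integral>\<^sup>+\<omega>. ennreal (s * (g i (U \<omega> z))\<^sup>2) \<partial>?\<Pi>)"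
      using s_nonneg by (subst nn_integral_add[symmetric]) (auto intro!: nn_integral_cong)
    also have "\<dots> = (\<integral>\<^sup>+\<omega>. ennreal ((p (U \<omega> z))\<^sup>2 + s * (\<Sum>k\<in>insert i I. (g k (U \<omega> z))\<^sup>2)) \<partial>?\<Pi>)"
      unfolding IH using s_nonneg insert.hyps
      by (subst nn_integral_add[symmetric])
         (auto intro!: nn_integral_cong sum_nonneg simp: algebra_simps sum_nonneg simp flip: ennreal_plus)
    finally show "(\<integral>\<^sup>+\<omega>. ennreal ((?q \<omega> z)\<^sup>2 + s * (g i (U \<omega> z))\<^sup>2) \<partial>?\<Pi>)
        = (\<integral>\<^sup>+\<omega>. ennreal ((p (U \<omega> z))\<^sup>2 + s * (\<Sum>k\<in>insert i I. (g k (U \<omega> z))\<^sup>2)) \<partial>?\<Pi>)" .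
  qed
  also have "\<dots> = (\<integral>\<^sup>+\<omega>. ennreal ((p (\<lambda>j\<in>insert i I. X (\<omega> j)))\<^sup>2 +
          s * (\<Sum>k\<in>insert i I. (g k (\<lambda>j\<in>insert i I. X (\<omega> j)))\<^sup>2)) \<partial>PiM (insert i I) (\<lambda>_. M))"
    using insert.hyps by (subst product_nn_integral_insert_rev) (auto simp: fun_upd_def restr)
  finally show ?case .
qed

end

section \<open>Risk of linear rules\<close>

text \<open>The form of \<open>G + \<mu> *\<^sub>R mat 1\<close> dominates
  \<open>\<mu> * (x \<bullet> x)\<close>, so the kernel is trivial and the matrix invertible.
  Pairing the resolvent equation with \<open>R *v y\<close> then shows nonnegativity.\<close>

lemma psd_resolvent:
  fixes G :: "real^'d^'d"
  assumes G: "psd G" and \<mu>: "0 < \<mu>"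
  defines "R \<equiv> matrix_inv (G + \<mu> *\<^sub>R mat 1)"
  shows resolvent_eq: "G *v (R *v y) + \<mu> *\<^sub>R (R *v y) = y"
    and resolvent_nonneg: "0 \<le> y \<bullet> (R *v y)"
proof -
  let ?A = "G + \<mu> *\<^sub>R mat 1"
  have A: "?A *v x = G *v x + \<mu> *\<^sub>R x" for x
    by (simp add: matrix_vector_mult_add_rdistrib scaleR_matrix_vector_assoc[symmetric])
  have "x = 0" if "?A *v x = 0" for x
  proof -
    have "x \<bullet> (G *v x) + \<mu> * (x \<bullet> x) = 0"
      using that by (metis A inner_add_right inner_scaleR_right inner_zero_right)
    moreover have "0 \<le> x \<bullet> (G *v x)" "0 \<le> \<mu> * (x \<bullet> x)" using G \<mu> by (simp_all add: psd_def)
    ultimately have "\<mu> * (x \<bullet> x) = 0" by linarith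
    then show ?thesis using \<mu> by simp
  qed
  then have "invertible ?A"
    by (simp add: invertible_left_inverse matrix_left_invertible_ker)
  then have "?A ** R = mat 1 \<and> R ** ?A = mat 1"
    unfolding R_def matrix_inv_def invertible_def by (rule someI_ex)
  then have "?A *v (R *v y) = y" by (simp add: matrix_vector_mul_assoc)
  then show eq: "G *v (R *v y) + \<mu> *\<^sub>R (R *v y) = y" by (simp add: A)
  have "y \<bullet> (R *v y) = (G *v (R *v y) + \<mu> *\<^sub>R (R *v y)) \<bullet> (R *v y)" by (simp add: eq)
  also have "\<dots> = (R *v y) \<bullet> (G *v (R *v y)) + \<mu> * ((R *v y) \<bullet> (R *v y))"
    by (subst inner_commute) (simp add: inner_add_right)
  also have "\<dots> \<ge> 0" using G \<mu> by (simp add: psd_def)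
  finally show "0 \<le> y \<bullet> (R *v y)" .
qed

text \<open>The scalar weight \<open>w\<close> covers both uses: \<open>w = 1\<close> for second
  moments, and the squared norm of the whitened input for the fourth moment matrix.\<close>

lemma integral_quadratic_form:
  fixes X :: "'a \<Rightarrow> real^'d" and w :: "'a \<Rightarrow> real"
  assumes int: "\<And>i j. integrable M (\<lambda>z. w z * X z $ i * X z $ j)"
  shows integrable_quadratic_form: "integrable M (\<lambda>z. w z * (X z \<bullet> a) * (X z \<bullet> b))"
    and integral_quadratic_form_eq: "(\<integral>z. w z * (X z \<bullet> a) * (X z \<bullet> b) \<partial>M)
      = a \<bullet> ((\<chi> i j. \<integral>z. w z * X z $ i * X z $ j \<partial>M) *v b)"
proof -
  have eq: "w z * (X z \<bullet> a) * (X z \<bullet> b)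
      = (\<Sum>i\<in>UNIV. \<Sum>j\<in>UNIV. (a $ i * b $ j) * (w z * X z $ i * X z $ j))" for z
    by (simp add: inner_vec_def sum_distrib_left sum_distrib_right ac_simps)
  show "integrable M (\<lambda>z. w z * (X z \<bullet> a) * (X z \<bullet> b))"
    unfolding eq using int by simp
  show "(\<integral>z. w z * (X z \<bullet> a) * (X z \<bullet> b) \<partial>M)
      = a \<bullet> ((\<chi> i j. \<integral>z. w z * X z $ i * X z $ j \<partial>M) *v b)"
  proof -
    have "(\<integral>z. w z * (X z \<bullet> a) * (X z \<bullet> b) \<partial>M)
        = (\<Sum>i\<in>UNIV. \<Sum>j\<in>UNIV. (a $ i * b $ j) * (\<integral>z. w z * X z $ i * X z $ j \<partial>M))"
      unfolding eq using int by simp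
    then show ?thesis
      by (simp add: inner_vec_def matrix_vector_mult_def sum_distrib_left ac_simps)
  qed
qed

lemma measurable_matrix_vector_mult [measurable (raw)]:
  fixes A :: "real^'n^'m"
  assumes "f \<in> borel_measurable M"
  shows "(\<lambda>x. A *v f x) \<in> borel_measurable M"
proof -
  have "(*v) A \<in> borel_measurable borel"
    by (intro borel_measurable_continuous_onI linear_continuous_on matrix_vector_mul_bounded_linear)
  then show ?thesis using assms by (rule measurable_compose[rotated])
qed

lemma psd_second_moment:
  assumes "\<And>i j. integrable \<nu> (\<lambda>\<theta>. \<theta> $ i * \<theta> $ j)"
  shows "psd (second_moment \<nu>)"
proof -
  have "v \<bullet> (second_moment \<nu> *v v) = (\<integral>\<theta>. 1 * (\<theta> \<bullet> v) * (\<theta> \<bullet> v) \<partial>\<nu>)" for v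
    using assms by (subst integral_quadratic_form_eq) (simp_all add: second_moment_def)
  then show ?thesis
    by (simp add: psd_def second_moment_def transpose_def vec_eq_iff mult.commute)
qed

section \<open>The regression model and the bias-variance form of the risk\<close>

locale regression =
  fixes P :: "((real^'d) \<times> real) measure" and \<sigma>2 :: real
  assumes P_prob: "prob_space P" and P_sets [measurable_cong]: "sets P = sets borel"
    and eps_sq_int: "integrable P (\<lambda>z. (snd z)\<^sup>2)"
    and cond_mean: "\<And>B. B \<in> sets borel \<Longrightarrow> (\<integral>z. indicator B (fst z) * snd z \<partial>P) = 0"
    and cond_var: "\<And>B. B \<in> sets borel \<Longrightarrow>
        (\<integral>z. indicator B (fst z) * (snd z)\<^sup>2 \<partial>P) = \<sigma>2 * (\<integral>z. indicator B (fst z) \<partial>P)"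
    and X_int: "\<And>i j. integrable P (\<lambda>z. (fst z)$i * (fst z)$j)"
begin

sublocale prob_space P by (rule P_prob)

lemma fst_meas [measurable]: "fst \<in> P \<rightarrow>\<^sub>M borel"
  unfolding measurable_cong_sets[OF P_sets refl]
  by (intro borel_measurable_continuous_onI continuous_intros)

lemma snd_meas [measurable]: "snd \<in> P \<rightarrow>\<^sub>M borel"
  unfolding measurable_cong_sets[OF P_sets refl]
  by (intro borel_measurable_continuous_onI continuous_intros)

sublocale cond_noise P borel fst snd \<sigma>2
  by unfold_locales (use eps_sq_int cond_mean cond_var in auto)

lemma prob_space_samples: "prob_space (PiM I (\<lambda>_. P))"
  by (intro prob_space_PiM P_prob)

lemma nn_integral_sample:
  assumes "i \<in> I" "f \<in> borel_measurable P"
  shows "(\<integral>\<^sup>+D. f (D i) \<partial>PiM I (\<lambda>_. P)) = (\<integral>\<^sup>+z. f z \<partial>P)"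
proof -
  have "distr (PiM I (\<lambda>_. P)) P (\<lambda>D. D i) = P"
    using assms(1) by (intro distr_PiM_component[of I "\<lambda>_. P"]) (auto simp: P_prob)
  then have "(\<integral>\<^sup>+z. f z \<partial>P) = (\<integral>\<^sup>+z. f z \<partial>distr (PiM I (\<lambda>_. P)) P (\<lambda>D. D i))" by simp
  also have "\<dots> = (\<integral>\<^sup>+D. f (D i) \<partial>PiM I (\<lambda>_. P))"
    using assms by (intro nn_integral_distr) auto
  finally show ?thesis by simp
qed

text \<open>The sampling distribution satisfies the noise model with respect to the trivial
  \<open>\<sigma>\<close>-algebra, so the noise identity specialises to the variance of a sample mean.\<close>
lemma sample_mean_variance:
  fixes f :: "(real^'d) \<times> real \<Rightarrow> real"
  assumes [measurable]: "f \<in> borel_measurable P"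
    and f2: "integrable P (\<lambda>z. (f z)\<^sup>2)" and f0: "(\<integral>z. f z \<partial>P) = 0" and I: "finite I"
  shows "(\<integral>\<^sup>+D. ennreal ((c + (\<Sum>i\<in>I. b * f (D i)))\<^sup>2) \<partial>PiM I (\<lambda>_. P))
    = ennreal (c\<^sup>2 + real (card I) * b\<^sup>2 * (\<integral>z. (f z)\<^sup>2 \<partial>P))"
proof -
  interpret f: cond_noise P "count_space (UNIV :: unit set)" "\<lambda>_. ()" f "\<integral>z. (f z)\<^sup>2 \<partial>P"
    by unfold_locales (auto simp: f2 f0 indicator_def prob_space)
  interpret Pi: prob_space "PiM I (\<lambda>_. P)" by (rule prob_space_samples)
  show ?thesis
    using f.noise_PiM[OF I, of "\<lambda>_. c" "\<lambda>_ _. b"] by (simp add: Pi.emeasure_space_1 ac_simps)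
qed

text \<open>The inner product of this vector with \<theta> is the bias of the rule at
  \<open>x\<close>, conditionally on the training inputs.\<close>

definition residual :: "nat \<Rightarrow> ((nat \<Rightarrow> real^'d) \<Rightarrow> real^'d \<Rightarrow> nat \<Rightarrow> real) \<Rightarrow>
    (nat \<Rightarrow> (real^'d) \<times> real) \<Rightarrow> real^'d \<Rightarrow> real^'d" where
  "residual n l D x = x - (\<Sum>i<n. l (\<lambda>j\<in>{..<n}. fst (D j)) x i *\<^sub>R fst (D i))"

text \<open>The noise identity is used twice: for the test noise, whose coefficient is 1 and which
  contributes the 1 beside the sum, and for the training noise with coefficients \<open>- l\<close>.
  The test point ends up outermost, so that later bounds can be proved for each test point
  separately.\<close>

lemma prediction_risk:
  fixes l :: "(nat \<Rightarrow> real^'d) \<Rightarrow> real^'d \<Rightarrow> nat \<Rightarrow> real"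
  assumes l: "\<And>i. i < n \<Longrightarrow> (\<lambda>(Xs, x). l Xs x i) \<in> borel_measurable (PiM {..<n} (\<lambda>_. borel) \<Otimes>\<^sub>M borel)"
  shows "(\<integral>\<^sup>+D. \<integral>\<^sup>+z. ennreal ((fst z \<bullet> \<theta> + snd z -
        (\<Sum>i<n. l (\<lambda>j\<in>{..<n}. fst (D j)) (fst z) i * (fst (D i) \<bullet> \<theta> + snd (D i))))\<^sup>2) \<partial>P \<partial>PiM {..<n} (\<lambda>_. P))
    = (\<integral>\<^sup>+z. \<integral>\<^sup>+D. ennreal ((residual n l D (fst z) \<bullet> \<theta>)\<^sup>2 +
        \<sigma>2 * (1 + (\<Sum>i<n. (l (\<lambda>j\<in>{..<n}. fst (D j)) (fst z) i)\<^sup>2))) \<partial>PiM {..<n} (\<lambda>_. P) \<partial>P)"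
proof -
  let ?\<Pi> = "PiM {..<n} (\<lambda>_. P)"
  interpret Pi: prob_space ?\<Pi> by (rule prob_space_samples)
  interpret pair_sigma_finite ?\<Pi> P by unfold_locales
  have lm[measurable (raw)]: "(\<lambda>w. l (a w) (b w) i) \<in> borel_measurable L"
    if "i < n" "a \<in> L \<rightarrow>\<^sub>M PiM {..<n} (\<lambda>_. borel)" "b \<in> L \<rightarrow>\<^sub>M borel" for a b i and L :: "'z measure"
    using measurable_compose[OF measurable_Pair[OF that(2,3)] l[OF that(1)]] by simp
  define W where "W D = (\<lambda>j\<in>{..<n}. fst (D j :: (real^'d) \<times> real))" for D
  have W[measurable]: "W \<in> ?\<Pi> \<rightarrow>\<^sub>M PiM {..<n} (\<lambda>_. borel)"
    unfolding W_def by measurable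
  let ?q = "\<lambda>D x. x \<bullet> \<theta> - (\<Sum>i<n. l (W D) x i * (fst (D i) \<bullet> \<theta> + snd (D i)))"
  have "(\<integral>\<^sup>+D. \<integral>\<^sup>+z. ennreal ((fst z \<bullet> \<theta> + snd z -
        (\<Sum>i<n. l (W D) (fst z) i * (fst (D i) \<bullet> \<theta> + snd (D i))))\<^sup>2) \<partial>P \<partial>?\<Pi>)
     = (\<integral>\<^sup>+D. \<integral>\<^sup>+z. ennreal ((?q D (fst z))\<^sup>2 + \<sigma>2) \<partial>P \<partial>?\<Pi>)"
  proof (rule nn_integral_cong)
    fix D assume D: "D \<in> space ?\<Pi>"
    then have [measurable]: "W D \<in> space (PiM {..<n} (\<lambda>_. borel))"
      using measurable_space[OF W] by blast
    show "(\<integral>\<^sup>+z. ennreal ((fst z \<bullet> \<theta> + snd z -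
        (\<Sum>i<n. l (W D) (fst z) i * (fst (D i) \<bullet> \<theta> + snd (D i))))\<^sup>2) \<partial>P)
      = (\<integral>\<^sup>+z. ennreal ((?q D (fst z))\<^sup>2 + \<sigma>2) \<partial>P)"
      using noise_single[of "?q D" "\<lambda>_. 1"] by (simp add: algebra_simps)
  qed
  also have "\<dots> = (\<integral>\<^sup>+z. \<integral>\<^sup>+D. ennreal ((?q D (fst z))\<^sup>2 + \<sigma>2) \<partial>?\<Pi> \<partial>P)"
    by (rule Fubini'[symmetric]) measurable
  also have "\<dots> = (\<integral>\<^sup>+z. \<integral>\<^sup>+D. ennreal ((residual n l D (fst z) \<bullet> \<theta>)\<^sup>2 +
        \<sigma>2 * (1 + (\<Sum>i<n. (l (W D) (fst z) i)\<^sup>2))) \<partial>?\<Pi> \<partial>P)"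
  proof (rule nn_integral_cong)
    fix z assume z[measurable]: "z \<in> space P"
    let ?x = "fst z"
    \<comment> \<open>For \<open>i < n\<close> the entry \<open>W D i\<close> is the training input,
      so the first bracket depends on the inputs alone and only the second sum contains
      noise.\<close>
    have q: "?q D ?x = (?x \<bullet> \<theta> - (\<Sum>i<n. l (W D) ?x i * (W D i \<bullet> \<theta>))) + (\<Sum>i<n. - l (W D) ?x i * snd (D i))" for D
      by (simp add: W_def sum.distrib sum_negf sum_subtractf distrib_left)
    have res: "residual n l D ?x \<bullet> \<theta> = ?x \<bullet> \<theta> - (\<Sum>i<n. l (W D) ?x i * (W D i \<bullet> \<theta>))" for D
      by (simp add: residual_def W_def inner_diff_left inner_sum_left)
    have *: "(\<integral>\<^sup>+D. ennreal ((?q D ?x)\<^sup>2) \<partial>?\<Pi>)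
      = (\<integral>\<^sup>+D. ennreal ((residual n l D ?x \<bullet> \<theta>)\<^sup>2 + \<sigma>2 * (\<Sum>i<n. (l (W D) ?x i)\<^sup>2)) \<partial>?\<Pi>)"
      unfolding q res
      using noise_PiM[of "{..<n}" "\<lambda>Y. ?x \<bullet> \<theta> - (\<Sum>i<n. l Y ?x i * (Y i \<bullet> \<theta>))" "\<lambda>i Y. - l Y ?x i"]
      by (simp add: W_def)
    have "(\<integral>\<^sup>+D. ennreal ((?q D ?x)\<^sup>2 + \<sigma>2) \<partial>?\<Pi>)
        = (\<integral>\<^sup>+D. ennreal ((?q D ?x)\<^sup>2) \<partial>?\<Pi>) + (\<integral>\<^sup>+D. ennreal \<sigma>2 \<partial>?\<Pi>)"
      using s_nonneg by (subst nn_integral_add[symmetric]) simp_all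
    also have "\<dots> = (\<integral>\<^sup>+D. ennreal ((residual n l D ?x \<bullet> \<theta>)\<^sup>2 + \<sigma>2 * (1 + (\<Sum>i<n. (l (W D) ?x i)\<^sup>2))) \<partial>?\<Pi>)"
    proof -
      have "ennreal (b\<^sup>2 + \<sigma>2 * (\<Sum>i<n. (f i)\<^sup>2)) + ennreal \<sigma>2 = ennreal (b\<^sup>2 + \<sigma>2 * (1 + (\<Sum>i<n. (f i)\<^sup>2)))"
        for b and f :: "nat \<Rightarrow> real"
        using s_nonneg by (simp add: sum_nonneg distrib_left algebra_simps flip: ennreal_plus)
      then show ?thesis
        unfolding * res by (subst nn_integral_add[symmetric]) simp_all
    qed
    finally show "(\<integral>\<^sup>+D. ennreal ((?q D ?x)\<^sup>2 + \<sigma>2) \<partial>?\<Pi>)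
      = (\<integral>\<^sup>+D. ennreal ((residual n l D ?x \<bullet> \<theta>)\<^sup>2 + \<sigma>2 * (1 + (\<Sum>i<n. (l (W D) ?x i)\<^sup>2))) \<partial>?\<Pi>)" .
  qed
  finally show ?thesis unfolding W_def .
qed

lemma weight_measurable:
  fixes l :: "(nat \<Rightarrow> real^'d) \<Rightarrow> real^'d \<Rightarrow> nat \<Rightarrow> real"
  assumes "(\<lambda>(Xs, x). l Xs x i) \<in> borel_measurable (PiM {..<n} (\<lambda>_. borel) \<Otimes>\<^sub>M borel)"
  shows "(\<lambda>w. l (\<lambda>j\<in>{..<n}. fst (snd w j)) (fst (fst w)) i) \<in> borel_measurable (P \<Otimes>\<^sub>M PiM {..<n} (\<lambda>_. P))"
proof -
  have "(\<lambda>w. ((\<lambda>j\<in>{..<n}. fst (snd w j)), fst (fst w)))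
      \<in> P \<Otimes>\<^sub>M PiM {..<n} (\<lambda>_. P) \<rightarrow>\<^sub>M PiM {..<n} (\<lambda>_. borel) \<Otimes>\<^sub>M borel"
    by measurable
  from measurable_compose[OF this assms] show ?thesis by simp
qed

lemma residual_measurable:
  fixes l :: "(nat \<Rightarrow> real^'d) \<Rightarrow> real^'d \<Rightarrow> nat \<Rightarrow> real"
  assumes l: "\<And>i. i < n \<Longrightarrow> (\<lambda>(Xs, x). l Xs x i) \<in> borel_measurable (PiM {..<n} (\<lambda>_. borel) \<Otimes>\<^sub>M borel)"
  shows "(\<lambda>w. residual n l (snd w) (fst (fst w))) \<in> borel_measurable (P \<Otimes>\<^sub>M PiM {..<n} (\<lambda>_. P))"
proof -
  have [measurable]: "(\<lambda>w. l (\<lambda>j\<in>{..<n}. fst (snd w j)) (fst (fst w)) i) \<in> borel_measurable (P \<Otimes>\<^sub>M PiM {..<n} (\<lambda>_. P))"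
    if "i < n" for i using that by (intro weight_measurable l)
  show ?thesis unfolding residual_def by measurable
qed

text \<open>Averaging \<open>(v \<bullet> \<theta>)\<^sup>2\<close> over \<nu> gives the form of the
  second moment matrix at \<open>v\<close>, which is the squared norm of \<open>S *v v\<close>. The
  variance part does not involve \<theta>, so Tonelli reduces the claim to this computation.\<close>

lemma averaged_prediction_risk:
  fixes l :: "(nat \<Rightarrow> real^'d) \<Rightarrow> real^'d \<Rightarrow> nat \<Rightarrow> real"
  assumes l: "\<And>i. i < n \<Longrightarrow> (\<lambda>(Xs, x). l Xs x i) \<in> borel_measurable (PiM {..<n} (\<lambda>_. borel) \<Otimes>\<^sub>M borel)"
    and nu_prob: "prob_space \<nu>" and nu_sets [measurable_cong]: "sets \<nu> = sets borel"
    and nu_int: "\<And>i j. integrable \<nu> (\<lambda>\<theta>. \<theta>$i * \<theta>$j)"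
    and S: "psd S" "S ** S = second_moment \<nu>"
  shows "(\<integral>\<^sup>+\<theta>. \<integral>\<^sup>+D. \<integral>\<^sup>+z. ennreal ((fst z \<bullet> \<theta> + snd z -
        (\<Sum>i<n. l (\<lambda>j\<in>{..<n}. fst (D j)) (fst z) i * (fst (D i) \<bullet> \<theta> + snd (D i))))\<^sup>2) \<partial>P \<partial>PiM {..<n} (\<lambda>_. P) \<partial>\<nu>)
    = (\<integral>\<^sup>+z. \<integral>\<^sup>+D. ennreal ((norm (S *v residual n l D (fst z)))\<^sup>2 +
        \<sigma>2 * (1 + (\<Sum>i<n. (l (\<lambda>j\<in>{..<n}. fst (D j)) (fst z) i)\<^sup>2))) \<partial>PiM {..<n} (\<lambda>_. P) \<partial>P)"
proof -
  let ?\<Pi> = "PiM {..<n} (\<lambda>_. P)"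
  interpret Pi: prob_space ?\<Pi> by (rule prob_space_samples)
  interpret nu: prob_space \<nu> by (rule nu_prob)
  interpret PP: pair_prob_space P ?\<Pi> by unfold_locales
  interpret nP: pair_sigma_finite \<nu> "P \<Otimes>\<^sub>M ?\<Pi>" by unfold_locales
  define r where "r w = residual n l (snd w) (fst (fst w))" for w :: "((real^'d) \<times> real) \<times> (nat \<Rightarrow> (real^'d) \<times> real)"
  define c where "c w = \<sigma>2 * (1 + (\<Sum>i<n. (l (\<lambda>j\<in>{..<n}. fst (snd w j)) (fst (fst w)) i)\<^sup>2))"
    for w :: "((real^'d) \<times> real) \<times> (nat \<Rightarrow> (real^'d) \<times> real)"
  have rm[measurable]: "r \<in> borel_measurable (P \<Otimes>\<^sub>M ?\<Pi>)"
    unfolding r_def[abs_def] by (rule residual_measurable[OF l])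
  have [measurable]: "(\<lambda>w. l (\<lambda>j\<in>{..<n}. fst (snd w j)) (fst (fst w)) i) \<in> borel_measurable (P \<Otimes>\<^sub>M ?\<Pi>)"
    if "i < n" for i using that by (intro weight_measurable l)
  have [measurable]: "c \<in> borel_measurable (P \<Otimes>\<^sub>M ?\<Pi>)"
    unfolding c_def by measurable
  have c0: "0 \<le> c w" for w
    using s_nonneg by (simp add: c_def sum_nonneg)
  have form: "(\<integral>\<^sup>+\<theta>. ennreal ((v \<bullet> \<theta>)\<^sup>2) \<partial>\<nu>) = ennreal ((norm (S *v v))\<^sup>2)" for v
  proof -
    have "(\<integral>\<^sup>+\<theta>. ennreal ((v \<bullet> \<theta>)\<^sup>2) \<partial>\<nu>) = (\<integral>\<^sup>+\<theta>. ennreal (1 * (\<theta> \<bullet> v) * (\<theta> \<bullet> v)) \<partial>\<nu>)"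
      by (simp add: power2_eq_square inner_commute)
    also have "\<dots> = ennreal (\<integral>\<theta>. 1 * (\<theta> \<bullet> v) * (\<theta> \<bullet> v) \<partial>\<nu>)"
      using nu_int by (intro nn_integral_eq_integral integrable_quadratic_form) simp_all
    also have "(\<integral>\<theta>. 1 * (\<theta> \<bullet> v) * (\<theta> \<bullet> v) \<partial>\<nu>) = v \<bullet> (second_moment \<nu> *v v)"
      using nu_int by (subst integral_quadratic_form_eq) (simp_all add: second_moment_def)
    also have "\<dots> = (norm (S *v v))\<^sup>2"
      by (simp add: S(2)[symmetric] matrix_vector_mul_assoc[symmetric] psd_inner_sym[OF S(1), symmetric]
          power2_norm_eq_inner)
    finally show ?thesis .
  qed
  have "(\<integral>\<^sup>+\<theta>. \<integral>\<^sup>+D. \<integral>\<^sup>+z. ennreal ((fst z \<bullet> \<theta> + snd z -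
        (\<Sum>i<n. l (\<lambda>j\<in>{..<n}. fst (D j)) (fst z) i * (fst (D i) \<bullet> \<theta> + snd (D i))))\<^sup>2) \<partial>P \<partial>?\<Pi> \<partial>\<nu>)
      = (\<integral>\<^sup>+\<theta>. \<integral>\<^sup>+z. \<integral>\<^sup>+D. ennreal ((r (z, D) \<bullet> \<theta>)\<^sup>2 + c (z, D)) \<partial>?\<Pi> \<partial>P \<partial>\<nu>)"
    by (rule nn_integral_cong, unfold r_def c_def fst_conv snd_conv, rule prediction_risk, rule l)
  also have "\<dots> = (\<integral>\<^sup>+\<theta>. \<integral>\<^sup>+w. ennreal ((r w \<bullet> \<theta>)\<^sup>2 + c w) \<partial>(P \<Otimes>\<^sub>M ?\<Pi>) \<partial>\<nu>)"
    by (rule nn_integral_cong, subst Pi.nn_integral_fst[symmetric]) simp_all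
  also have "\<dots> = (\<integral>\<^sup>+w. \<integral>\<^sup>+\<theta>. ennreal ((r w \<bullet> \<theta>)\<^sup>2 + c w) \<partial>\<nu> \<partial>(P \<Otimes>\<^sub>M ?\<Pi>))"
    by (rule nP.Fubini'[symmetric]) measurable
  also have "\<dots> = (\<integral>\<^sup>+w. ennreal ((norm (S *v r w))\<^sup>2 + c w) \<partial>(P \<Otimes>\<^sub>M ?\<Pi>))"
  proof (rule nn_integral_cong)
    fix w
    have "(\<integral>\<^sup>+\<theta>. ennreal ((r w \<bullet> \<theta>)\<^sup>2 + c w) \<partial>\<nu>) = (\<integral>\<^sup>+\<theta>. ennreal ((r w \<bullet> \<theta>)\<^sup>2) \<partial>\<nu>) + (\<integral>\<^sup>+\<theta>. ennreal (c w) \<partial>\<nu>)"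
      using c0 by (subst nn_integral_add[symmetric]) simp_all
    then show "(\<integral>\<^sup>+\<theta>. ennreal ((r w \<bullet> \<theta>)\<^sup>2 + c w) \<partial>\<nu>) = ennreal ((norm (S *v r w))\<^sup>2 + c w)"
      using c0 by (simp add: form nu.emeasure_space_1)
  qed
  also have "\<dots> = (\<integral>\<^sup>+z. \<integral>\<^sup>+D. ennreal ((norm (S *v r (z, D)))\<^sup>2 + c (z, D)) \<partial>?\<Pi> \<partial>P)"
    by (subst Pi.nn_integral_fst[symmetric]) simp_all
  finally show ?thesis by (simp add: r_def c_def)
qed

end

section \<open>Whitened inputs and ridge directions\<close>

locale whitened_regression = regression P \<sigma>2
  for P :: "((real^'d) \<times> real) measure" and \<sigma>2 :: real +
  fixes S G :: "real^'d^'d"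
  assumes S_psd: "psd S" and G_eq: "G = S ** Sigma_of P ** S"
begin

text \<open>The theorem is obtained with \<open>S\<close> the square root of the second moment
  matrix of \<nu>; then \<open>Xt\<close> is the whitened input and \<open>G\<close> its second
  moment matrix.\<close>

definition Xt :: "(real^'d) \<times> real \<Rightarrow> real^'d" where "Xt z = S *v fst z"

lemma Xt_meas [measurable]: "Xt \<in> borel_measurable P"
  unfolding Xt_def by measurable

lemma Xt_form:
  shows Xt_form_int: "integrable P (\<lambda>z. (Xt z \<bullet> a) * (Xt z \<bullet> b))"
    and Xt_form_eq: "(\<integral>z. (Xt z \<bullet> a) * (Xt z \<bullet> b) \<partial>P) = a \<bullet> (G *v b)"
proof -
  have eq: "(Xt z \<bullet> a) * (Xt z \<bullet> b) = 1 * (fst z \<bullet> (S *v a)) * (fst z \<bullet> (S *v b))" for z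
    by (simp add: Xt_def psd_inner_sym[OF S_psd])
  show "integrable P (\<lambda>z. (Xt z \<bullet> a) * (Xt z \<bullet> b))"
    unfolding eq using X_int by (intro integrable_quadratic_form) simp
  have "(\<integral>z. (Xt z \<bullet> a) * (Xt z \<bullet> b) \<partial>P) = (S *v a) \<bullet> (Sigma_of P *v (S *v b))"
    unfolding eq using X_int by (subst integral_quadratic_form_eq) (simp_all add: Sigma_of_def)
  then show "(\<integral>z. (Xt z \<bullet> a) * (Xt z \<bullet> b) \<partial>P) = a \<bullet> (G *v b)"
    by (simp add: G_eq matrix_vector_mul_assoc[symmetric] psd_inner_sym[OF S_psd])
qed

lemma G_nth: "G $ i $ j = (\<integral>z. Xt z $ i * Xt z $ j \<partial>P)"
  using Xt_form_eq[of "axis i 1" "axis j 1"]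
  by (simp add: inner_axis inner_axis' matrix_vector_mult_basis column_def)

lemma G_psd: "psd G"
proof -
  have "0 \<le> v \<bullet> (G *v v)" for v
    unfolding Xt_form_eq[symmetric] by (intro Bochner_Integration.integral_nonneg) simp
  then show ?thesis
    by (simp add: psd_def transpose_def vec_eq_iff G_nth mult.commute)
qed

lemma integral_bilinear:
  shows bilinear_int: "integrable P (\<lambda>z. Xt z \<bullet> (R *v Xt z))"
    and bilinear_eq: "(\<integral>z. Xt z \<bullet> (R *v Xt z) \<partial>P) = trace (G ** R)"
proof -
  have eq: "Xt z \<bullet> (R *v Xt z) = (\<Sum>i\<in>UNIV. \<Sum>j\<in>UNIV. R $ i $ j * (Xt z $ j * Xt z $ i))" for z
    by (simp add: inner_vec_def matrix_vector_mult_def sum_distrib_left ac_simps)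
  have int: "integrable P (\<lambda>z. Xt z $ j * Xt z $ i)" for i j
    using Xt_form_int[of "axis j 1" "axis i 1"] by (simp add: inner_axis)
  show "integrable P (\<lambda>z. Xt z \<bullet> (R *v Xt z))"
    unfolding eq using int by simp
  have "(\<integral>z. Xt z \<bullet> (R *v Xt z) \<partial>P) = (\<Sum>i\<in>UNIV. \<Sum>j\<in>UNIV. R $ i $ j * G $ j $ i)"
    unfolding eq G_nth using int by simp
  also have "\<dots> = trace (R ** G)"
    by (simp add: trace_def matrix_matrix_mult_def)
  finally show "(\<integral>z. Xt z \<bullet> (R *v Xt z) \<partial>P) = trace (G ** R)"
    by (subst trace_mul_sym)
qed

text \<open>The vector \<open>v\<^sub>\<mu>\<close> attached to a test point. It uses the population
  matrix \<open>G\<close>, hence is independent of the training sample and can be held fixed while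
  averaging over it.\<close>

definition ridge_dir :: "real \<Rightarrow> (real^'d) \<times> real \<Rightarrow> real^'d" where
  "ridge_dir \<mu> z = matrix_inv (G + \<mu> *\<^sub>R mat 1) *v Xt z"

lemma ridge_dir_eq: "0 < \<mu> \<Longrightarrow> G *v ridge_dir \<mu> z + \<mu> *\<^sub>R ridge_dir \<mu> z = Xt z"
  unfolding ridge_dir_def by (rule resolvent_eq[OF G_psd])

lemma ridge_dir_nonneg: "0 < \<mu> \<Longrightarrow> 0 \<le> Xt z \<bullet> ridge_dir \<mu> z"
  unfolding ridge_dir_def by (rule resolvent_nonneg[OF G_psd])

text \<open>The ridge equation paired with its own solution. This identity collapses the terms
  produced by averaging over the sample, in the lower and in the upper bound alike.\<close>

lemma ridge_dir_form:
  assumes "0 < \<mu>"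
  shows "ridge_dir \<mu> z \<bullet> (G *v ridge_dir \<mu> z) + \<mu> * (ridge_dir \<mu> z \<bullet> ridge_dir \<mu> z) = Xt z \<bullet> ridge_dir \<mu> z"
proof -
  have "Xt z \<bullet> ridge_dir \<mu> z = ridge_dir \<mu> z \<bullet> (G *v ridge_dir \<mu> z + \<mu> *\<^sub>R ridge_dir \<mu> z)"
    by (subst ridge_dir_eq[OF assms]) (rule inner_commute)
  then show ?thesis by (simp add: inner_add_right)
qed

text \<open>The integral of \<open>Xt z \<bullet> ridge_dir \<mu> z\<close> is the trace defining
  \<open>df1\<close>. The constant \<open>b\<close> carries the irreducible noise
  \<open>\<sigma>2\<close> along.\<close>

lemma nn_integral_ridge_dir:
  assumes "0 < \<mu>" "0 \<le> b"
  shows "(\<integral>\<^sup>+z. ennreal (b + \<mu> * (Xt z \<bullet> ridge_dir \<mu> z)) \<partial>P) = ennreal (b + \<mu> * df1 G \<mu>)"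
proof -
  have int: "integrable P (\<lambda>z. Xt z \<bullet> ridge_dir \<mu> z)"
    unfolding ridge_dir_def by (rule bilinear_int)
  have "(\<integral>\<^sup>+z. ennreal (b + \<mu> * (Xt z \<bullet> ridge_dir \<mu> z)) \<partial>P) = ennreal (\<integral>z. b + \<mu> * (Xt z \<bullet> ridge_dir \<mu> z) \<partial>P)"
    using int assms by (intro nn_integral_eq_integral) (auto simp: ridge_dir_nonneg)
  also have "(\<integral>z. b + \<mu> * (Xt z \<bullet> ridge_dir \<mu> z) \<partial>P) = b + \<mu> * df1 G \<mu>"
    using int by (simp add: prob_space) (simp add: ridge_dir_def bilinear_eq df1_def)
  finally show ?thesis .
qed

lemma df1_nonneg:
  assumes "0 < \<mu>"
  shows "0 \<le> df1 G \<mu>"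
proof -
  have "0 \<le> (\<integral>z. Xt z \<bullet> ridge_dir \<mu> z \<partial>P)"
    by (intro Bochner_Integration.integral_nonneg ridge_dir_nonneg assms)
  then show ?thesis by (simp add: ridge_dir_def bilinear_eq df1_def)
qed

lemma nn_integral_Xt_sq: "(\<integral>\<^sup>+z. ennreal ((Xt z \<bullet> v)\<^sup>2) \<partial>P) = ennreal (v \<bullet> (G *v v))"
proof -
  have "(\<integral>\<^sup>+z. ennreal ((Xt z \<bullet> v) * (Xt z \<bullet> v)) \<partial>P) = ennreal (\<integral>z. (Xt z \<bullet> v) * (Xt z \<bullet> v) \<partial>P)"
    by (intro nn_integral_eq_integral Xt_form_int) simp
  then show ?thesis by (simp add: Xt_form_eq power2_eq_square)
qed

lemma nn_integral_sum_Xt_sq: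
  "(\<integral>\<^sup>+D. ennreal (\<Sum>i<n. (Xt (D i) \<bullet> v)\<^sup>2) \<partial>PiM {..<n} (\<lambda>_. P)) = ennreal (real n * (v \<bullet> (G *v v)))"
proof -
  have "(\<integral>\<^sup>+D. ennreal (\<Sum>i<n. (Xt (D i) \<bullet> v)\<^sup>2) \<partial>PiM {..<n} (\<lambda>_. P))
      = (\<Sum>i<n. \<integral>\<^sup>+D. ennreal ((Xt (D i) \<bullet> v)\<^sup>2) \<partial>PiM {..<n} (\<lambda>_. P))"
    by (subst nn_integral_sum[symmetric]) auto
  also have "\<dots> = (\<Sum>i<n. ennreal (v \<bullet> (G *v v)))"
    by (intro sum.cong refl, subst nn_integral_sample[where f="\<lambda>z. ennreal ((Xt z \<bullet> v)\<^sup>2)"])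
       (auto simp: nn_integral_Xt_sq)
  also have "\<dots> = ennreal (real n * (v \<bullet> (G *v v)))"
    using G_psd by (simp add: psd_def ennreal_mult ennreal_of_nat_eq_real_of_nat)
  finally show ?thesis .
qed

lemma S_residual:
  "S *v residual n l D (fst z) = Xt z - (\<Sum>i<n. l (\<lambda>j\<in>{..<n}. fst (D j)) (fst z) i *\<^sub>R Xt (D i))"
  by (simp add: residual_def Xt_def matrix_vector_mult_diff_distrib linear_sum[OF matrix_vector_mul_linear]
      matrix_vector_mult_scaleR)

end

text \<open>Lagrangian duality for ridge regression: the dual variable \<open>v\<close> bounds the penalised
  residual from below uniformly in the weights.\<close>
lemma ridge_dual_bound:
  fixes x v :: "'a::real_inner" and a :: "nat \<Rightarrow> 'a" and lam :: real
  assumes n: "n \<ge> 1" and lam: "0 \<le> lam"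
  shows "2 * lam * (x \<bullet> v) \<le> (norm (x - (\<Sum>i<n. l i *\<^sub>R a i)))\<^sup>2 + (real n * lam) * (\<Sum>i<n. (l i)\<^sup>2)
      + lam * ((\<Sum>i<n. (a i \<bullet> v)\<^sup>2) / real n + lam * (v \<bullet> v))"
proof -
  define r where "r = x - (\<Sum>i<n. l i *\<^sub>R a i)"
  have xv: "x \<bullet> v = r \<bullet> v + (\<Sum>i<n. l i * (a i \<bullet> v))"
    by (simp add: r_def inner_diff_left inner_sum_left)
  \<comment> \<open>After splitting \<open>x \<bullet> v\<close> into the residual part and the
    weight part, each product is bounded by completing a square. Equality would hold at
    \<open>r = lam *\<^sub>R v\<close> and \<open>l i = (a i \<bullet> v) / real n\<close>.\<close>
  have "0 \<le> (r - lam *\<^sub>R v) \<bullet> (r - lam *\<^sub>R v)" by simp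
  then have 1: "2 * lam * (r \<bullet> v) \<le> (norm r)\<^sup>2 + lam * (lam * (v \<bullet> v))"
    by (simp add: inner_diff_left inner_diff_right inner_commute power2_norm_eq_inner)
  have "2 * lam * (l i * (a i \<bullet> v)) \<le> real n * lam * (l i)\<^sup>2 + lam * ((a i \<bullet> v)\<^sup>2 / real n)" for i
  proof -
    have "0 \<le> real n * lam * (l i - (a i \<bullet> v) / real n)\<^sup>2" using lam by simp
    also have "\<dots> = real n * lam * (l i)\<^sup>2 + lam * ((a i \<bullet> v)\<^sup>2 / real n) - 2 * lam * (l i * (a i \<bullet> v))"
      using n by (simp add: power2_eq_square field_simps)
    finally show ?thesis by simp
  qed
  then have "(\<Sum>i<n. 2 * lam * (l i * (a i \<bullet> v)))
      \<le> (\<Sum>i<n. real n * lam * (l i)\<^sup>2 + lam * ((a i \<bullet> v)\<^sup>2 / real n))"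
    by (intro sum_mono)
  then have "2 * lam * (\<Sum>i<n. l i * (a i \<bullet> v))
      \<le> real n * lam * (\<Sum>i<n. (l i)\<^sup>2) + lam * ((\<Sum>i<n. (a i \<bullet> v)\<^sup>2) / real n)"
    by (simp add: sum.distrib sum_distrib_left sum_divide_distrib)
  with 1 show ?thesis
    unfolding r_def[symmetric] xv by (simp add: distrib_left)
qed

section \<open>The lower bound for every linear rule\<close>

context whitened_regression
begin

text \<open>For each test point the dual bound is applied with its ridge direction. It gains
  \<open>2 * lam * q\<close> with \<open>q = Xt z \<bullet> ridge_dir lam z\<close> and costs a
  correction whose mean over the sample is exactly \<open>lam * q\<close>, leaving
  \<open>lam * q\<close>.\<close>

lemma risk_lower:
  fixes l :: "(nat \<Rightarrow> real^'d) \<Rightarrow> real^'d \<Rightarrow> nat \<Rightarrow> real"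
  assumes l: "\<And>i. i < n \<Longrightarrow> (\<lambda>(Xs, x). l Xs x i) \<in> borel_measurable (PiM {..<n} (\<lambda>_. borel) \<Otimes>\<^sub>M borel)"
    and n: "n \<ge> 1" and lam: "0 < lam" "\<sigma>2 = real n * lam"
  shows "ennreal (\<sigma>2 + lam * df1 G lam)
    \<le> (\<integral>\<^sup>+z. \<integral>\<^sup>+D. ennreal ((norm (S *v residual n l D (fst z)))\<^sup>2 +
        \<sigma>2 * (1 + (\<Sum>i<n. (l (\<lambda>j\<in>{..<n}. fst (D j)) (fst z) i)\<^sup>2))) \<partial>PiM {..<n} (\<lambda>_. P) \<partial>P)"
proof -
  let ?\<Pi> = "PiM {..<n} (\<lambda>_. P)"
  interpret Pi: prob_space ?\<Pi> by (rule prob_space_samples)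
  have [measurable]: "(\<lambda>D. l (\<lambda>j\<in>{..<n}. fst (D j)) (fst z) i) \<in> borel_measurable ?\<Pi>"
    if "i < n" for i z
  proof -
    have "(\<lambda>D. ((\<lambda>j\<in>{..<n}. fst (D j)), fst z)) \<in> ?\<Pi> \<rightarrow>\<^sub>M PiM {..<n} (\<lambda>_. borel) \<Otimes>\<^sub>M borel"
      by measurable
    from measurable_compose[OF this l[OF that]] show ?thesis by simp
  qed
  have "ennreal (\<sigma>2 + lam * (Xt z \<bullet> ridge_dir lam z))
      \<le> (\<integral>\<^sup>+D. ennreal ((norm (S *v residual n l D (fst z)))\<^sup>2 +
        \<sigma>2 * (1 + (\<Sum>i<n. (l (\<lambda>j\<in>{..<n}. fst (D j)) (fst z) i)\<^sup>2))) \<partial>?\<Pi>)" (is "_ \<le> (\<integral>\<^sup>+D. ennreal (?f D) \<partial>_)") for z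
  proof -
    define v where "v = ridge_dir lam z"
    define q where "q = Xt z \<bullet> v"
    define h where "h D = lam * ((\<Sum>i<n. (Xt (D i) \<bullet> v)\<^sup>2) / real n + lam * (v \<bullet> v))" for D
    have h0: "0 \<le> h D" for D using lam by (simp add: h_def sum_nonneg)
    have f0: "0 \<le> ?f D" for D using s_nonneg by (simp add: sum_nonneg)
    have q0: "0 \<le> q" unfolding q_def v_def using lam(1) by (rule ridge_dir_nonneg)
    have fm: "(\<lambda>D. ennreal (?f D)) \<in> borel_measurable ?\<Pi>"
      unfolding residual_def by measurable
    have hm: "(\<lambda>D. ennreal (h D)) \<in> borel_measurable ?\<Pi>"
      unfolding h_def by measurable
    have "(\<integral>\<^sup>+D. ennreal (h D) \<partial>?\<Pi>)
        = (\<integral>\<^sup>+D. ennreal (lam / real n) * ennreal (\<Sum>i<n. (Xt (D i) \<bullet> v)\<^sup>2) + ennreal (lam * (lam * (v \<bullet> v))) \<partial>?\<Pi>)"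
      using lam by (intro nn_integral_cong)
        (simp add: h_def sum_nonneg distrib_left flip: ennreal_mult ennreal_plus)
    also have "\<dots> = ennreal (lam / real n) * ennreal (real n * (v \<bullet> (G *v v))) + ennreal (lam * (lam * (v \<bullet> v)))"
      by (subst nn_integral_add, measurable)
         (simp add: nn_integral_cmult nn_integral_sum_Xt_sq Pi.emeasure_space_1)
    also have "\<dots> = ennreal (lam * q)"
      unfolding q_def v_def ridge_dir_form[OF lam(1), symmetric] using G_psd lam n
      by (simp add: psd_def distrib_left flip: ennreal_mult ennreal_plus)
    finally have hint: "(\<integral>\<^sup>+D. ennreal (h D) \<partial>?\<Pi>) = ennreal (lam * q)" .
    have pt: "\<sigma>2 + 2 * lam * q \<le> ?f D + h D" for D
      using ridge_dual_bound[OF n less_imp_le[OF lam(1)], of "Xt z" v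
          "\<lambda>i. l (\<lambda>j\<in>{..<n}. fst (D j)) (fst z) i" "\<lambda>i. Xt (D i)"]
      unfolding q_def h_def S_residual by (simp add: lam(2) distrib_left)
    \<comment> \<open>The finite amount \<open>lam * q\<close> stays as a summand on both sides, so
      that it can be cancelled in \<open>ennreal\<close> even if the risk is infinite.\<close>
    have "ennreal (\<sigma>2 + lam * q) + ennreal (lam * q) = (\<integral>\<^sup>+D. ennreal (\<sigma>2 + 2 * lam * q) \<partial>?\<Pi>)"
      using q0 lam s_nonneg by (simp add: Pi.emeasure_space_1 flip: ennreal_plus)
    also have "\<dots> \<le> (\<integral>\<^sup>+D. ennreal (?f D) + ennreal (h D) \<partial>?\<Pi>)"
      using pt h0 f0 by (intro nn_integral_mono) (simp flip: ennreal_plus add: ennreal_leI)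
    also have "\<dots> = (\<integral>\<^sup>+D. ennreal (?f D) \<partial>?\<Pi>) + ennreal (lam * q)"
      using fm hm by (simp add: nn_integral_add hint)
    finally have "ennreal (\<sigma>2 + lam * q) \<le> (\<integral>\<^sup>+D. ennreal (?f D) \<partial>?\<Pi>)"
      by simp
    then show ?thesis by (simp add: q_def v_def)
  qed
  then show ?thesis
    unfolding nn_integral_ridge_dir[OF lam(1) s_nonneg, symmetric] by (intro nn_integral_mono)
qed

end

section \<open>Population ridge weights\<close>

context whitened_regression
begin

text \<open>By the ridge equation the residual has mean \<open>\<mu> *\<^sub>R v\<close>. Its
  fluctuation is that of a sample mean of the vectors \<open>(x \<bullet> v) *\<^sub>R x\<close>,
  whose total variance is at most the fourth moment form at \<open>v\<close>, divided by
  \<open>n\<close>.\<close>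

lemma population_ridge_residual:
  fixes z :: "(real^'d) \<times> real"
  assumes fourth_int: "\<And>i j. integrable P (\<lambda>z. (norm (Xt z))\<^sup>2 * Xt z $ i * Xt z $ j)"
    and fourth: "loewner_le (\<chi> i j. \<integral>z. (norm (Xt z))\<^sup>2 * Xt z $ i * Xt z $ j \<partial>P) (L2 *\<^sub>R G)"
    and n: "n \<ge> 1" and \<mu>: "0 < \<mu>"
  defines "v \<equiv> ridge_dir \<mu> z"
  shows "(\<integral>\<^sup>+D. ennreal ((norm (Xt z - (\<Sum>i<n. ((Xt (D i) \<bullet> v) / real n) *\<^sub>R Xt (D i))))\<^sup>2) \<partial>PiM {..<n} (\<lambda>_. P))
    \<le> ennreal (\<mu>\<^sup>2 * (v \<bullet> v) + L2 / real n * (v \<bullet> (G *v v)))"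
proof -
  let ?\<Pi> = "PiM {..<n} (\<lambda>_. P)"
  have norm_sq: "(norm u)\<^sup>2 = (\<Sum>k\<in>UNIV. (u $ k)\<^sup>2)" for u :: "real^'d"
    unfolding power2_norm_eq_inner inner_vec_def by (simp add: power2_eq_square)
  \<comment> \<open>The vector is treated one coordinate at a time, which makes the scalar lemma on
    sample means applicable; \<open>m\<close> is the coordinatewise mean.\<close>
  define w where "w k z' = (Xt z' \<bullet> v) * Xt z' $ k" for k z'
  define m where "m k = (G *v v) $ k" for k
  have w_int: "integrable P (w k)" and w_mean: "(\<integral>z'. w k z' \<partial>P) = m k" for k
    using Xt_form_int[of "axis k 1" v] Xt_form_eq[of "axis k 1" v]
    by (simp_all add: w_def[abs_def] m_def inner_axis inner_axis' mult.commute)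
  have wm[measurable]: "w k \<in> borel_measurable P" for k
    using w_int by auto
  have sum_w: "(\<Sum>k\<in>UNIV. (w k z')\<^sup>2) = (norm (Xt z'))\<^sup>2 * (Xt z' \<bullet> v) * (Xt z' \<bullet> v)" for z'
  proof -
    have "(\<Sum>k\<in>UNIV. (w k z')\<^sup>2) = (Xt z' \<bullet> v)\<^sup>2 * (\<Sum>k\<in>UNIV. (Xt z' $ k)\<^sup>2)"
      by (simp add: w_def power_mult_distrib sum_distrib_left)
    then show ?thesis unfolding norm_sq by (simp add: power2_eq_square ac_simps)
  qed
  have q_int: "integrable P (\<lambda>z'. (norm (Xt z'))\<^sup>2 * (Xt z' \<bullet> v) * (Xt z' \<bullet> v))"
    by (intro integrable_quadratic_form fourth_int)
  have w2_int: "integrable P (\<lambda>z'. (w k z')\<^sup>2)" for k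
  proof (rule Bochner_Integration.integrable_bound[OF q_int])
    have le: "(w k z')\<^sup>2 \<le> (norm (Xt z'))\<^sup>2 * (Xt z' \<bullet> v) * (Xt z' \<bullet> v)" for z'
      using member_le_sum[of k UNIV "\<lambda>k. (w k z')\<^sup>2"] by (simp add: sum_w)
    show "AE z' in P. norm ((w k z')\<^sup>2) \<le> norm ((norm (Xt z'))\<^sup>2 * (Xt z' \<bullet> v) * (Xt z' \<bullet> v))"
      using order_trans[OF le abs_ge_self] by simp
  qed simp
  define f where "f k z' = w k z' - m k" for k z'
  have fm[measurable]: "f k \<in> borel_measurable P" for k
    unfolding f_def by measurable
  have f2: "(f k z')\<^sup>2 = (w k z')\<^sup>2 - 2 * m k * w k z' + (m k)\<^sup>2" for k z'
    by (simp add: f_def power2_eq_square algebra_simps)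
  have f2_int: "integrable P (\<lambda>z'. (f k z')\<^sup>2)" for k
    unfolding f2 using w2_int w_int by simp
  have f_mean: "(\<integral>z'. f k z' \<partial>P) = 0" for k
    unfolding f_def using w_int w_mean by (simp add: prob_space)
  \<comment> \<open>A variance is at most the second moment; the discarded term is
    \<open>(m k)\<^sup>2\<close>.\<close>
  have f_var: "(\<integral>z'. (f k z')\<^sup>2 \<partial>P) \<le> (\<integral>z'. (w k z')\<^sup>2 \<partial>P)" for k
    unfolding f2 using w2_int w_int by (simp add: prob_space w_mean power2_eq_square)
  have "(\<Sum>k\<in>UNIV. \<integral>z'. (f k z')\<^sup>2 \<partial>P) \<le> (\<Sum>k\<in>UNIV. \<integral>z'. (w k z')\<^sup>2 \<partial>P)"
    by (intro sum_mono f_var)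
  also have "\<dots> = (\<integral>z'. (norm (Xt z'))\<^sup>2 * (Xt z' \<bullet> v) * (Xt z' \<bullet> v) \<partial>P)"
    using w2_int by (subst Bochner_Integration.integral_sum[symmetric]) (simp_all add: sum_w)
  also have "\<dots> = v \<bullet> ((\<chi> i j. \<integral>z. (norm (Xt z))\<^sup>2 * Xt z $ i * Xt z $ j \<partial>P) *v v)"
    by (intro integral_quadratic_form_eq fourth_int)
  also have "\<dots> \<le> L2 * (v \<bullet> (G *v v))"
  proof -
    have "0 \<le> v \<bullet> ((L2 *\<^sub>R G - (\<chi> i j. \<integral>z. (norm (Xt z))\<^sup>2 * Xt z $ i * Xt z $ j \<partial>P)) *v v)"
      using fourth unfolding loewner_le_def psd_def by blast
    then show ?thesis
      by (simp add: matrix_vector_mult_diff_rdistrib inner_diff_right scaleR_matrix_vector_assoc[symmetric])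
  qed
  finally have var: "(\<Sum>k\<in>UNIV. \<integral>z'. (f k z')\<^sup>2 \<partial>P) \<le> L2 * (v \<bullet> (G *v v))" .
  have comp: "(Xt z - (\<Sum>i<n. ((Xt (D i) \<bullet> v) / real n) *\<^sub>R Xt (D i))) $ k
      = \<mu> * v $ k + (\<Sum>i<n. (- 1 / real n) * f k (D i))" for D k
  proof -
    have "Xt z $ k = m k + \<mu> * v $ k"
      unfolding m_def v_def using ridge_dir_eq[OF \<mu>, of z]
      by (metis vector_add_component vector_scaleR_component real_scaleR_def)
    then show ?thesis
      using n by (simp add: f_def w_def sum_subtractf diff_divide_distrib sum_negf sum_divide_distrib)
  qed
  have "(\<integral>\<^sup>+D. ennreal ((norm (Xt z - (\<Sum>i<n. ((Xt (D i) \<bullet> v) / real n) *\<^sub>R Xt (D i))))\<^sup>2) \<partial>?\<Pi>)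
      = (\<integral>\<^sup>+D. (\<Sum>k\<in>UNIV. ennreal ((\<mu> * v $ k + (\<Sum>i<n. (- 1 / real n) * f k (D i)))\<^sup>2)) \<partial>?\<Pi>)"
    by (simp only: norm_sq comp) simp
  also have "\<dots> = (\<Sum>k\<in>UNIV. \<integral>\<^sup>+D. ennreal ((\<mu> * v $ k + (\<Sum>i<n. (- 1 / real n) * f k (D i)))\<^sup>2) \<partial>?\<Pi>)"
    by (rule nn_integral_sum) measurable
  \<comment> \<open>With \<open>n\<close> independent terms of coefficient
    \<open>- 1 / real n\<close>, the variance factor is \<open>1 / real n\<close>.\<close>
  also have "\<dots> = (\<Sum>k\<in>UNIV. ennreal ((\<mu> * v $ k)\<^sup>2 + (\<integral>z'. (f k z')\<^sup>2 \<partial>P) / real n))"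
    using n
    by (intro sum.cong refl, subst sample_mean_variance[OF fm f2_int f_mean])
       (simp_all add: power2_eq_square)
  also have "\<dots> = ennreal (\<Sum>k\<in>UNIV. (\<mu> * v $ k)\<^sup>2 + (\<integral>z'. (f k z')\<^sup>2 \<partial>P) / real n)"
    by (intro sum_ennreal) simp
  also have "(\<Sum>k\<in>UNIV. (\<mu> * v $ k)\<^sup>2 + (\<integral>z'. (f k z')\<^sup>2 \<partial>P) / real n)
      = \<mu>\<^sup>2 * (v \<bullet> v) + (\<Sum>k\<in>UNIV. \<integral>z'. (f k z')\<^sup>2 \<partial>P) / real n"
    by (simp add: sum.distrib power_mult_distrib sum_distrib_left sum_divide_distrib inner_vec_def
        power2_eq_square ac_simps)
  also have "ennreal \<dots> \<le> ennreal (\<mu>\<^sup>2 * (v \<bullet> v) + L2 / real n * (v \<bullet> (G *v v)))"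
    using divide_right_mono[OF var, of "real n"] by (intro ennreal_leI) simp
  finally show ?thesis .
qed

text \<open>The form \<open>v \<bullet> (G *v v)\<close> enters twice: with factor
  \<open>L2 / real n\<close> from the fluctuation of the residual and with
  \<open>\<sigma>2 / real n\<close> from the noise passed on by the weights. Together they make
  \<open>\<mu>\<close>, so the total is again of the shape in \<open>ridge_dir_form\<close>.\<close>

lemma risk_upper:
  assumes fourth_int: "\<And>i j. integrable P (\<lambda>z. (norm (Xt z))\<^sup>2 * Xt z $ i * Xt z $ j)"
    and fourth: "loewner_le (\<chi> i j. \<integral>z. (norm (Xt z))\<^sup>2 * Xt z $ i * Xt z $ j \<partial>P) (L2 *\<^sub>R G)"
    and n: "n \<ge> 1" and \<mu>: "0 < \<mu>" "real n * \<mu> = \<sigma>2 + L2" and L2: "0 \<le> L2"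
  defines "l \<equiv> \<lambda>Xs x i. ((S *v Xs i) \<bullet> (matrix_inv (G + \<mu> *\<^sub>R mat 1) *v (S *v x))) / real n"
  shows "(\<integral>\<^sup>+z. \<integral>\<^sup>+D. ennreal ((norm (S *v residual n l D (fst z)))\<^sup>2 +
        \<sigma>2 * (1 + (\<Sum>i<n. (l (\<lambda>j\<in>{..<n}. fst (D j)) (fst z) i)\<^sup>2))) \<partial>PiM {..<n} (\<lambda>_. P) \<partial>P)
    \<le> ennreal (\<sigma>2 + \<mu> * df1 G \<mu>)"
proof -
  let ?\<Pi> = "PiM {..<n} (\<lambda>_. P)"
  interpret Pi: prob_space ?\<Pi> by (rule prob_space_samples)
  have "(\<integral>\<^sup>+D. ennreal ((norm (S *v residual n l D (fst z)))\<^sup>2 +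
        \<sigma>2 * (1 + (\<Sum>i<n. (l (\<lambda>j\<in>{..<n}. fst (D j)) (fst z) i)\<^sup>2))) \<partial>?\<Pi>)
    \<le> ennreal (\<sigma>2 + \<mu> * (Xt z \<bullet> ridge_dir \<mu> z))" for z
  proof -
    define v where "v = ridge_dir \<mu> z"
    define r where "r D = Xt z - (\<Sum>i<n. ((Xt (D i) \<bullet> v) / real n) *\<^sub>R Xt (D i))" for D
    have l: "l (\<lambda>j\<in>{..<n}. fst (D j)) (fst z) i = (Xt (D i) \<bullet> v) / real n" if "i < n" for D i
      using that by (simp add: l_def v_def ridge_dir_def Xt_def)
    have r: "S *v residual n l D (fst z) = r D" for D
      unfolding S_residual r_def by (simp add: l)
    have rm[measurable]: "r \<in> borel_measurable ?\<Pi>"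
      unfolding r_def by measurable
    have sum_l: "(\<Sum>i<n. (l (\<lambda>j\<in>{..<n}. fst (D j)) (fst z) i)\<^sup>2) = (\<Sum>i<n. (Xt (D i) \<bullet> v)\<^sup>2) / (real n)\<^sup>2" for D
      by (simp add: l power_divide sum_divide_distrib)
    have vGv: "0 \<le> v \<bullet> (G *v v)" using G_psd by (simp add: psd_def)
    have "(\<integral>\<^sup>+D. ennreal ((norm (r D))\<^sup>2 + \<sigma>2 * (1 + (\<Sum>i<n. (Xt (D i) \<bullet> v)\<^sup>2) / (real n)\<^sup>2)) \<partial>?\<Pi>)
        = (\<integral>\<^sup>+D. ennreal ((norm (r D))\<^sup>2) + (ennreal \<sigma>2 + ennreal (\<sigma>2 / (real n)\<^sup>2) * ennreal (\<Sum>i<n. (Xt (D i) \<bullet> v)\<^sup>2)) \<partial>?\<Pi>)"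
      using s_nonneg by (intro nn_integral_cong)
        (simp add: sum_nonneg distrib_left flip: ennreal_mult ennreal_plus)
    also have "\<dots> = (\<integral>\<^sup>+D. ennreal ((norm (r D))\<^sup>2) \<partial>?\<Pi>) +
        (ennreal \<sigma>2 + ennreal (\<sigma>2 / (real n)\<^sup>2) * ennreal (real n * (v \<bullet> (G *v v))))"
      by (simp add: nn_integral_add nn_integral_cmult nn_integral_sum_Xt_sq Pi.emeasure_space_1)
    also have "\<dots> \<le> ennreal (\<mu>\<^sup>2 * (v \<bullet> v) + L2 / real n * (v \<bullet> (G *v v))) +
        (ennreal \<sigma>2 + ennreal (\<sigma>2 / (real n)\<^sup>2) * ennreal (real n * (v \<bullet> (G *v v))))"
      unfolding r_def v_def
      by (intro add_right_mono population_ridge_residual[OF fourth_int fourth n \<mu>(1)])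
    also have "\<dots> = ennreal (\<sigma>2 + (\<mu> * (\<mu> * (v \<bullet> v)) + ((L2 + \<sigma>2) / real n) * (v \<bullet> (G *v v))))"
      using s_nonneg n L2 vGv \<mu>(1)
      by (simp add: power2_eq_square add_divide_distrib distrib_right algebra_simps flip: ennreal_mult ennreal_plus)
    also have "(L2 + \<sigma>2) / real n = \<mu>"
      using n \<mu>(2) by (simp add: field_simps)
    also have "\<mu> * (\<mu> * (v \<bullet> v)) + \<mu> * (v \<bullet> (G *v v)) = \<mu> * (Xt z \<bullet> ridge_dir \<mu> z)"
      unfolding v_def ridge_dir_form[OF \<mu>(1), symmetric] by (simp add: algebra_simps)
    finally show ?thesis by (simp add: r sum_l)
  qed
  then show ?thesis
    unfolding nn_integral_ridge_dir[OF \<mu>(1) s_nonneg, symmetric] by (intro nn_integral_mono)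
qed

end

section \<open>Randomised rules and the two bounds\<close>

lemma (in regression) bayes_risk_rule_eq:
  assumes rule: "lin_rule n Q l"
    and nu_prob: "prob_space \<nu>" and nu_sets [measurable_cong]: "sets \<nu> = sets borel"
    and nu_int: "\<And>i j. integrable \<nu> (\<lambda>\<theta>. \<theta>$i * \<theta>$j)"
    and S: "psd S" "S ** S = second_moment \<nu>"
  shows "bayes_risk_rule n P \<nu> Q l =
    (\<integral>\<^sup>+\<xi>. \<integral>\<^sup>+z. \<integral>\<^sup>+D. ennreal ((norm (S *v residual n (l \<xi>) D (fst z)))\<^sup>2 +
        \<sigma>2 * (1 + (\<Sum>i<n. (l \<xi> (\<lambda>j\<in>{..<n}. fst (D j)) (fst z) i)\<^sup>2))) \<partial>PiM {..<n} (\<lambda>_. P) \<partial>P \<partial>Q)"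
proof -
  let ?\<Pi> = "PiM {..<n} (\<lambda>_. P)"
  interpret Pi: prob_space ?\<Pi> by (rule prob_space_samples)
  interpret nu: prob_space \<nu> by (rule nu_prob)
  interpret Q: prob_space Q using rule by (simp add: lin_rule_def)
  have Q_sets[measurable_cong]: "sets Q = sets borel" using rule by (simp add: lin_rule_def)
  interpret nQ: pair_sigma_finite \<nu> Q by unfold_locales
  have l: "(\<lambda>(\<xi>, Xs, x). l \<xi> Xs x i) \<in> borel_measurable (borel \<Otimes>\<^sub>M (PiM {..<n} (\<lambda>_. borel) \<Otimes>\<^sub>M borel))"
    if "i < n" for i using rule that by (simp add: lin_rule_def)
  have lm[measurable (raw)]: "(\<lambda>w. l (c w) (a w) (b w) i) \<in> borel_measurable L"
    if "i < n" "c \<in> L \<rightarrow>\<^sub>M borel" "a \<in> L \<rightarrow>\<^sub>M PiM {..<n} (\<lambda>_. borel)" "b \<in> L \<rightarrow>\<^sub>M borel"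
    for a b c i and L :: "'z measure"
    using measurable_compose[OF measurable_Pair[OF that(2) measurable_Pair[OF that(3,4)]] l[OF that(1)]] by simp
  have fixed: "(\<lambda>(Xs, x). l \<xi> Xs x i) \<in> borel_measurable (PiM {..<n} (\<lambda>_. borel) \<Otimes>\<^sub>M borel)" if "i < n" for \<xi> i
    using that by measurable
  \<comment> \<open>Tonelli moves the auxiliary randomness outermost; for each of its values the
    rule is deterministic.\<close>
  have "bayes_risk_rule n P \<nu> Q l = (\<integral>\<^sup>+\<xi>. \<integral>\<^sup>+\<theta>. \<integral>\<^sup>+D. \<integral>\<^sup>+z. ennreal ((fst z \<bullet> \<theta> + snd z -
        (\<Sum>i<n. l \<xi> (\<lambda>j\<in>{..<n}. fst (D j)) (fst z) i * (fst (D i) \<bullet> \<theta> + snd (D i))))\<^sup>2) \<partial>P \<partial>?\<Pi> \<partial>\<nu> \<partial>Q)"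
    unfolding bayes_risk_rule_def lin_pred_def by (rule nQ.Fubini'[symmetric]) measurable
  also have "\<dots> = (\<integral>\<^sup>+\<xi>. \<integral>\<^sup>+z. \<integral>\<^sup>+D. ennreal ((norm (S *v residual n (l \<xi>) D (fst z)))\<^sup>2 +
        \<sigma>2 * (1 + (\<Sum>i<n. (l \<xi> (\<lambda>j\<in>{..<n}. fst (D j)) (fst z) i)\<^sup>2))) \<partial>?\<Pi> \<partial>P \<partial>Q)"
    by (rule nn_integral_cong, rule averaged_prediction_risk[OF _ nu_prob nu_sets nu_int S], rule fixed)
  finally show ?thesis .
qed

theorem theorem1:
  fixes n :: nat and \<sigma>2 L_H :: real
    and P :: "((real^'d) \<times> real) measure"
    and \<nu> :: "(real^'d) measure"
    and A :: "real^'d^'d"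
  assumes n_pos: "n \<ge> 1"
    and P_prob: "prob_space P" and P_sets: "sets P = sets borel"
    and eps_sq_int: "integrable P (\<lambda>z. (snd z)\<^sup>2)"
    and cond_mean: "\<And>B. B \<in> sets borel \<Longrightarrow> (\<integral>z. indicator B (fst z) * snd z \<partial>P) = 0"
    and cond_var: "\<And>B. B \<in> sets borel \<Longrightarrow>
        (\<integral>z. indicator B (fst z) * (snd z)\<^sup>2 \<partial>P) = \<sigma>2 * (\<integral>z. indicator B (fst z) \<partial>P)"
    and X_int: "\<And>i j. integrable P (\<lambda>z. (fst z)$i * (fst z)$j)"
    and A_psd: "psd A"
    and nu_prob: "prob_space \<nu>" and nu_sets: "sets \<nu> = sets borel"
    and nu_supp: "AE \<theta> in \<nu>. norm (A *v \<theta>) = 1"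
    and nu_int: "\<And>i j. integrable \<nu> (\<lambda>\<theta>. \<theta>$i * \<theta>$j)"
    and L_pos: "L_H > 0"
    and Xt_int: "\<And>i j. integrable P (\<lambda>z.
        (norm (msqrt (second_moment \<nu>) *v fst z))\<^sup>2 *
        (msqrt (second_moment \<nu>) *v fst z)$i * (msqrt (second_moment \<nu>) *v fst z)$j)"
    and fourth: "loewner_le
        (\<chi> i j. \<integral>z. (norm (msqrt (second_moment \<nu>) *v fst z))\<^sup>2 *
              (msqrt (second_moment \<nu>) *v fst z)$i * (msqrt (second_moment \<nu>) *v fst z)$j \<partial>P)
        (L_H\<^sup>2 *\<^sub>R (msqrt (second_moment \<nu>) ** Sigma_of P ** msqrt (second_moment \<nu>)))"
  shows "ereal ((\<sigma>2 / real n) *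
           df1 (msqrt (second_moment \<nu>) ** Sigma_of P ** msqrt (second_moment \<nu>)) (\<sigma>2 / real n))
           \<le> bayes_excess n P \<nu> \<sigma>2
       \<and> bayes_excess n P \<nu> \<sigma>2
           \<le> ereal ((\<sigma>2 / real n + L_H\<^sup>2 / real n) *
           df1 (msqrt (second_moment \<nu>) ** Sigma_of P ** msqrt (second_moment \<nu>))
               (\<sigma>2 / real n + L_H\<^sup>2 / real n))"
proof
  define S where "S = msqrt (second_moment \<nu>)"
  define G where "G = S ** Sigma_of P ** S"
  have H: "psd (second_moment \<nu>)" by (rule psd_second_moment[OF nu_int])
  have S: "psd S" "S ** S = second_moment \<nu>"
    unfolding S_def using psd_msqrt[OF H] msqrt_mult[OF H] by auto
  interpret whitened_regression P \<sigma>2 S G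
    by (intro whitened_regression.intro regression.intro whitened_regression_axioms.intro)
       (fact P_prob P_sets eps_sq_int cond_mean cond_var X_int S(1) G_def)+
  note risk = bayes_risk_rule_eq[OF _ nu_prob nu_sets nu_int S]
  \<comment> \<open>The side condition \<open>0 \<le> \<sigma>2 + a\<close> is needed because
    \<open>ennreal\<close> sends negative numbers to 0.\<close>
  have minus: "ereal a \<le> enn2ereal R - ereal \<sigma>2" if "ennreal (\<sigma>2 + a) \<le> R" "0 \<le> \<sigma>2 + a" for a R
  proof -
    have "ereal (\<sigma>2 + a) \<le> enn2ereal R"
      using that by (metis enn2ereal_ennreal less_eq_ennreal.rep_eq)
    then have "ereal (\<sigma>2 + a) - ereal \<sigma>2 \<le> enn2ereal R - ereal \<sigma>2"
      by (intro ereal_minus_mono) auto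
    then show ?thesis by simp
  qed
  show "ereal ((\<sigma>2 / real n) *
       df1 (msqrt (second_moment \<nu>) ** Sigma_of P ** msqrt (second_moment \<nu>)) (\<sigma>2 / real n))
       \<le> bayes_excess n P \<nu> \<sigma>2"
    unfolding bayes_excess_def S_def[symmetric] G_def[symmetric]
  proof (rule INF_greatest, clarsimp)
    fix Q :: "real measure" and l :: "real \<Rightarrow> (nat \<Rightarrow> real^'d) \<Rightarrow> real^'d \<Rightarrow> nat \<Rightarrow> real"
    assume rule: "lin_rule n Q l"
    interpret Q: prob_space Q using rule by (simp add: lin_rule_def)
    have l: "(\<lambda>(Xs, x). l \<xi> Xs x i) \<in> borel_measurable (PiM {..<n} (\<lambda>_. borel) \<Otimes>\<^sub>M borel)" if "i < n" for \<xi> i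
    proof -
      have "(\<lambda>(\<xi>, Xs, x). l \<xi> Xs x i) \<in> borel_measurable (borel \<Otimes>\<^sub>M (PiM {..<n} (\<lambda>_. borel) \<Otimes>\<^sub>M borel))"
        using rule that by (simp add: lin_rule_def)
      from measurable_compose[OF measurable_Pair1'[of \<xi> borel] this] show ?thesis
        by (simp add: case_prod_beta')
    qed
    show "ereal (\<sigma>2 * df1 G (\<sigma>2 / real n) / real n) \<le> enn2ereal (bayes_risk_rule n P \<nu> Q l) - ereal \<sigma>2"
    \<comment> \<open>For \<open>\<sigma>2 = 0\<close> the regularisation vanishes and no ridge
      direction is available, but the bound to prove is then 0 and the risk is nonnegative.\<close>
    proof (cases "\<sigma>2 = 0")
      case True
      then show ?thesis by (intro minus) auto
    next
      case False
      define lam where "lam = \<sigma>2 / real n"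
      have lam: "0 < lam" "\<sigma>2 = real n * lam"
        using False s_nonneg n_pos by (auto simp: lam_def)
      have "ennreal (\<sigma>2 + lam * df1 G lam) = (\<integral>\<^sup>+\<xi>. ennreal (\<sigma>2 + lam * df1 G lam) \<partial>Q)"
        by (simp add: Q.emeasure_space_1)
      also have "\<dots> \<le> bayes_risk_rule n P \<nu> Q l"
        unfolding risk[OF rule]
        by (rule nn_integral_mono, rule risk_lower[OF _ n_pos lam], rule l)
      finally have "ereal (lam * df1 G lam) \<le> enn2ereal (bayes_risk_rule n P \<nu> Q l) - ereal \<sigma>2"
        using lam(1) df1_nonneg[OF lam(1)] s_nonneg by (intro minus) auto
      then show ?thesis by (simp add: lam_def)
    qed
  qed
  define \<mu> where "\<mu> = \<sigma>2 / real n + L_H\<^sup>2 / real n"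
  have \<mu>: "0 < \<mu>" "real n * \<mu> = \<sigma>2 + L_H\<^sup>2"
    using n_pos L_pos s_nonneg by (auto simp: \<mu>_def distrib_left intro!: add_nonneg_pos)
  \<comment> \<open>The witness for the upper bound: population ridge weights. They may involve
    \<open>G\<close>, since the infimum is taken for fixed \<open>P\<close> and \<nu>. The
    randomness is trivial, \<open>Q\<close> being a point mass.\<close>
  define l :: "real \<Rightarrow> (nat \<Rightarrow> real^'d) \<Rightarrow> real^'d \<Rightarrow> nat \<Rightarrow> real" where
    "l = (\<lambda>\<xi> Xs x i. ((S *v Xs i) \<bullet> (matrix_inv (G + \<mu> *\<^sub>R mat 1) *v (S *v x))) / real n)"
  define Q :: "real measure" where "Q = return borel 0"
  have Q: "prob_space Q" "sets Q = sets borel" by (auto simp: Q_def prob_space_return)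
  interpret Q: prob_space Q by (rule Q)
  have rule: "lin_rule n Q l"
    unfolding lin_rule_def l_def using Q by auto
  have "bayes_risk_rule n P \<nu> Q l \<le> (\<integral>\<^sup>+\<xi>. ennreal (\<sigma>2 + \<mu> * df1 G \<mu>) \<partial>Q)"
    unfolding risk[OF rule] unfolding l_def
    by (rule nn_integral_mono, rule risk_upper[OF Xt_int[folded S_def Xt_def] fourth[folded S_def, folded G_def Xt_def] n_pos \<mu>]) simp
  also have "\<dots> = ennreal (\<sigma>2 + \<mu> * df1 G \<mu>)" by (simp add: Q.emeasure_space_1)
  finally have "enn2ereal (bayes_risk_rule n P \<nu> Q l) \<le> ereal (\<sigma>2 + \<mu> * df1 G \<mu>)"
    using s_nonneg \<mu>(1) df1_nonneg[OF \<mu>(1)]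
    by (metis add_nonneg_nonneg enn2ereal_ennreal less_eq_ennreal.rep_eq less_imp_le mult_nonneg_nonneg)
  then have "enn2ereal (bayes_risk_rule n P \<nu> Q l) - ereal \<sigma>2 \<le> ereal (\<sigma>2 + \<mu> * df1 G \<mu>) - ereal \<sigma>2"
    by (intro ereal_minus_mono) auto
  moreover have "bayes_excess n P \<nu> \<sigma>2 \<le> enn2ereal (bayes_risk_rule n P \<nu> Q l) - ereal \<sigma>2"
    unfolding bayes_excess_def by (rule INF_lower2[of "(Q, l)"]) (auto simp: rule)
  ultimately show "bayes_excess n P \<nu> \<sigma>2
       \<le> ereal ((\<sigma>2 / real n + L_H\<^sup>2 / real n) *
       df1 (msqrt (second_moment \<nu>) ** Sigma_of P ** msqrt (second_moment \<nu>))
           (\<sigma>2 / real n + L_H\<^sup>2 / real n))"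
    unfolding S_def[symmetric] G_def[symmetric] \<mu>_def[symmetric] by (auto intro: order_trans)
qed

end
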